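(* Let $\sigma$ be a term ordering, let $F$ be a formula in 2-XNF, and let $G$ be an implication graph structure for $F$. Then the procedure $\mathrm{GGCP}$ (described in the context) is an algorithm, i.e. it terminates after finitely many steps, which returns a $\sigma$-reduced implication graph structure $G'=\mathrm{GGCP}_\sigma(G)$ for $F$ such that $G'\preceq G$.
   Context: $\mathbb{B}_n=\mathbb{F}_2[X_1,\dots,X_n]/\langle X_1^2-X_1,\dots,X_n^2-X_n\rangle$ is the ring of Boolean polynomials, $x_i$ the residue class of $X_i$, and $\mathbb{L}_n=\langle 1,x_1,\dots,x_n\rangle_{\mathbb{F}_2}$ the space of linear Boolean polynomials. $\mathrm{Supp}(f)$ is the set of square-free terms occurring in $f$. A term ordering $\sigma$ on $\mathbb{F}_2[X_1,\dots,X_n]$ induces an ordering on the square-free terms of $\mathbb{B}_n$, and $\mathrm{LT}_\sigma(f)$ is the largest term in $\mathrm{Supp}(f)$; $\mathrm{LT}_\sigma(L)$ is the set of leading terms of the elements of $L$. $\mathrm{NR}_\sigma(f,L)$ is the normal remainder of $f$ under the division algorithm by the elements of $L$ with respect to $\sigma$ (performed on the canonical square-free representatives). A lineral is an XOR of literals; a formula is in 2-XNF if it is a conjunction of clauses each of which is a disjunction of at most two linerals. For such a formula $F$ in the variables $X_1,\dots,X_n$ (true $=1$, false $=0$), $I_F\subseteq\mathbb{B}_n$ is the unique ideal whose zero set in $\mathbb{F}_2^n$ equals the set of satisfying assignments of $F$. An implication graph structure (IGS) for $F$ is a tuple $(L,V,E)$ with $L,V\subseteq\mathbb{L}_n$ and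 $E\subseteq V^2$ such that (1) $I_F=\langle L\rangle+\langle fg\mid (f+1,g)\in E\rangle$; (2) for all $(f+1,g)\in E$ we have $(g+1,f)\in E$; (3) for all $f\in V$, $(f,f)\notin E$. It is $\sigma$-reduced if the polynomials in $L$ have pairwise distinct leading terms and $\mathrm{LT}_\sigma(L)\cap\bigcup_{f\in V}\mathrm{Supp}(f)=\emptyset$. For two IGSs $G'=(L',V',E')$ and $G=(L,V,E)$ for $F$, $G'\preceq G$ means $\langle L'\rangle_{\mathbb{F}_2}\supseteq\langle L\rangle_{\mathbb{F}_2}$ and $\#V'\le\#V$. Procedure $\mathrm{GGCP}$, with input an IGS $G$ for $F$ and a term ordering $\sigma$: Line 1: Write $G=(L,V,E)$ and $\mathrm{LT}_\sigma$-interreduce $L$ (i.e. pass to a generating set of the same $\mathbb{F}_2$-span whose elements have pairwise distinct leading terms). Line 2: Let $(L',V',E')=(L,\emptyset,\emptyset)$. Lines 3-8: For each $(f,g)\in E$: let $f'=\mathrm{NR}_\sigma(f,L)$ and $g'=\mathrm{NR}_\sigma(g,L)$; if $f'=0$ and $g'\ne0$, append $g'$ to $L'$; if $g'=1$ and $f'\neq1$, append $f'+1$ to $L'$; if $f'\notin\mathbb{F}_2$ and $g'\notin\mathbb{F}_2$ and $f'\ne g'$, append $(f',g')$ to $E'$ and append $f'$ and $g'$ to $V'$. Line 9: If $L\ne L'$, set $(L,V,E)=(L',V',E')$ and go to Line 2. Line 10: Otherwise return $(L',V',E')$.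
   Formalization: Line 9 is read as "go to Line 1": the new L is interreduced again before each further round. With the literal jump to Line 2, the output may contain two polynomials with the same leading term and so fail to be σ-reduced. *)

theory Defs
  imports Complex_Main "HOL-Library.Poly_Mapping" "HOL-Library.Z2"
begin

section \<open>Boolean polynomials\<close>

text \<open>
  \<open>'v mpoly\<close> is the polynomial ring over the field with two elements (type \<open>bit\<close>) whose
  indeterminates are the elements of \<open>'v\<close>; for \<open>'v\<close> with \<open>n\<close> elements these play the role of
  \<open>X_1, ..., X_n\<close>. Terms are exponent vectors, so products of terms are written additively.
\<close>

type_synonym 'v trm = "'v \<Rightarrow>\<^sub>0 nat"
type_synonym 'v mpoly = "('v \<Rightarrow>\<^sub>0 nat) \<Rightarrow>\<^sub>0 bit"

definition indet :: "'v \<Rightarrow> 'v mpoly" where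
  "indet v = Poly_Mapping.single (Poly_Mapping.single v 1) 1"

definition eval_trm :: "('v \<Rightarrow> bit) \<Rightarrow> 'v trm \<Rightarrow> bit" where
  "eval_trm a t = (\<Prod>v\<in>Poly_Mapping.keys t. a v ^ Poly_Mapping.lookup t v)"

definition eval_mpoly :: "('v \<Rightarrow> bit) \<Rightarrow> 'v mpoly \<Rightarrow> bit" where
  "eval_mpoly a p = (\<Sum>t\<in>Poly_Mapping.keys p. Poly_Mapping.lookup p t * eval_trm a t)"

lemma eval_trm_add: "eval_trm a (s + t) = eval_trm a s * eval_trm a t"
proof -
  let ?K = "Poly_Mapping.keys s \<union> Poly_Mapping.keys t"
  have ext: "eval_trm a u = (\<Prod>v\<in>?K. a v ^ Poly_Mapping.lookup u v)"
    if "Poly_Mapping.keys u \<subseteq> ?K" for u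
    unfolding eval_trm_def by (rule prod.mono_neutral_left) (use that in \<open>auto simp: in_keys_iff\<close>)
  show ?thesis
    unfolding ext[OF keys_add] ext[OF Un_upper1] ext[OF Un_upper2] lookup_add power_add
    by (rule prod.distrib)
qed

lemma eval_mpoly_zero [simp]: "eval_mpoly a 0 = 0"
  by (simp add: eval_mpoly_def)

lemma eval_mpoly_add: "eval_mpoly a (p + q) = eval_mpoly a p + eval_mpoly a q"
  unfolding eval_mpoly_def
  by (rule setsum_keys_plus_distrib[where f = "\<lambda>t c. c * eval_trm a t"]) (simp_all only: mult_zero_left distrib_right)

lemma eval_mpoly_single: "eval_mpoly a (Poly_Mapping.single t c) = c * eval_trm a t"
  by (simp add: eval_mpoly_def)

lemma mpoly_induct [case_names zero single add]:
  assumes "P 0" "\<And>t c. P (Poly_Mapping.single t c)" "\<And>p q. P p \<Longrightarrow> P q \<Longrightarrow> P (p + q)"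
  shows "P (p :: 'v mpoly)"
proof (induction p rule: update_induct)
  case (update f t c)
  have "Poly_Mapping.update t c f = Poly_Mapping.single t c + f"
    using update(1) by (intro poly_mapping_eqI) (auto simp: lookup_update lookup_add lookup_single in_keys_iff)
  then show ?case using assms update by simp
qed (fact assms(1))

lemma eval_mpoly_mult: "eval_mpoly a (p * q) = eval_mpoly a p * eval_mpoly a q"
proof (induction p rule: mpoly_induct)
  case (single s c)
  show ?case
  proof (induction q rule: mpoly_induct)
    case (single t d)
    show ?case by (simp add: mult_single eval_mpoly_single eval_trm_add)
  qed (simp_all only: distrib_left eval_mpoly_add eval_mpoly_zero mult_zero_right)
qed (simp_all only: distrib_right eval_mpoly_add eval_mpoly_zero mult_zero_left)

lemma eval_mpoly_one [simp]: "eval_mpoly a 1 = 1"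
  by (simp add: eval_mpoly_def eval_trm_def lookup_one)

lemma eval_mpoly_diff: "eval_mpoly a (p - q) = eval_mpoly a p - eval_mpoly a q"
proof -
  have "eval_mpoly a p = eval_mpoly a (p - q) + eval_mpoly a q"
    by (simp only: diff_add_cancel flip: eval_mpoly_add)
  then show ?thesis by (simp only: add_diff_cancel_right')
qed

text \<open>Ideals of a commutative ring are the submodules of the ring over itself.\<close>

global_interpretation ring_module: module "(*) :: 'a::comm_ring_1 \<Rightarrow> 'a \<Rightarrow> 'a"
  defines is_ideal = ring_module.subspace
    and ideal_gen = ring_module.span
  by unfold_locales (simp_all add: algebra_simps)

definition field_ideal :: "'v mpoly set" where
  "field_ideal = ideal_gen (range (\<lambda>v. indet v ^ 2 - indet v))"

lemma eval_mpoly_field_ideal: "p \<in> field_ideal \<Longrightarrow> eval_mpoly a p = 0"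
  unfolding field_ideal_def
proof (induction rule: ring_module.span_induct_alt)
  case (step c x y)
  then obtain v where "x = indet v ^ 2 - indet v" by blast
  then have "eval_mpoly a x = 0"
    by (simp only: eval_mpoly_diff power2_eq_square eval_mpoly_mult) simp
  with step show ?case by (simp only: eval_mpoly_add eval_mpoly_mult) simp
qed simp

text \<open>The ring of Boolean polynomials; \<open>residue p\<close> is the residue class of \<open>p\<close>.\<close>

quotient_type 'v bpoly = "('v \<Rightarrow>\<^sub>0 nat) \<Rightarrow>\<^sub>0 bit" / "\<lambda>p q :: 'v mpoly. p - q \<in> field_ideal"
  morphisms rep_bpoly residue
proof (intro equivpI reflpI sympI transpI)
  fix p q r :: "'v mpoly"
  show "p - p \<in> field_ideal"
    by (simp add: field_ideal_def ring_module.span_zero)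
  show "q - p \<in> field_ideal" if "p - q \<in> field_ideal"
    using ring_module.span_neg[of "p - q"] that by (simp add: field_ideal_def)
  show "p - r \<in> field_ideal" if "p - q \<in> field_ideal" "q - r \<in> field_ideal"
    using ring_module.span_add[of "p - q" _ "q - r"] that by (simp add: field_ideal_def)
qed

instantiation bpoly :: (type) comm_ring_1
begin

lift_definition zero_bpoly :: "'v bpoly" is 0 .
lift_definition one_bpoly :: "'v bpoly" is 1 .

lift_definition plus_bpoly :: "'v bpoly \<Rightarrow> 'v bpoly \<Rightarrow> 'v bpoly" is "(+)"
  unfolding field_ideal_def add_diff_add by (rule ring_module.span_add)

lift_definition minus_bpoly :: "'v bpoly \<Rightarrow> 'v bpoly \<Rightarrow> 'v bpoly" is "(-)"
proof -
  fix p q r s :: "'v mpoly"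
  assume "p - q \<in> field_ideal" "r - s \<in> field_ideal"
  moreover have "(p - r) - (q - s) = (p - q) - (r - s)" by simp
  ultimately show "(p - r) - (q - s) \<in> field_ideal"
    unfolding field_ideal_def by (simp only: ring_module.span_diff)
qed

lift_definition uminus_bpoly :: "'v bpoly \<Rightarrow> 'v bpoly" is "uminus"
  unfolding field_ideal_def minus_diff_minus by (rule ring_module.span_neg)

lift_definition times_bpoly :: "'v bpoly \<Rightarrow> 'v bpoly \<Rightarrow> 'v bpoly" is "(*)"
proof -
  fix p q r s :: "'v mpoly"
  assume "p - q \<in> field_ideal" "r - s \<in> field_ideal"
  moreover have "p * r - q * s = r * (p - q) + q * (r - s)" by (simp add: algebra_simps)
  ultimately show "p * r - q * s \<in> field_ideal"
    unfolding field_ideal_def by (simp only: ring_module.span_add ring_module.span_scale)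
qed

instance
proof
  show "(0 :: 'v bpoly) \<noteq> 1"
  proof (transfer, rule notI)
    assume "(0 :: 'v mpoly) - 1 \<in> field_ideal"
    from eval_mpoly_field_ideal[OF this] have "(0 :: bit) - 1 = 0"
      by (simp only: eval_mpoly_diff eval_mpoly_zero eval_mpoly_one)
    then show False by simp
  qed
  have zero: "(0 :: 'v mpoly) \<in> field_ideal"
    by (simp add: field_ideal_def ring_module.span_zero)
  fix a b c :: "'v bpoly"
  show "a * b * c = a * (b * c)" by transfer (simp only: mult.assoc diff_self zero)
  show "a * b = b * a" by transfer (simp only: mult.commute diff_self zero)
  show "1 * a = a" by transfer (simp only: mult_1_left diff_self zero)
  show "a + b + c = a + (b + c)" by transfer (simp only: add.assoc diff_self zero)
  show "a + b = b + a" by transfer (simp only: add.commute diff_self zero)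
  show "0 + a = a" by transfer (simp only: add_0_left diff_self zero)
  show "- a + a = 0" by transfer (simp only: left_minus diff_self zero)
  show "a - b = a + - b" by transfer (simp only: add_uminus_conv_diff diff_self zero)
  show "(a + b) * c = a * c + b * c" by transfer (simp only: distrib_right diff_self zero)
qed

end

definition var :: "'v \<Rightarrow> 'v bpoly" where
  "var v = residue (indet v)"

lift_definition eval_bpoly :: "('v \<Rightarrow> bit) \<Rightarrow> 'v bpoly \<Rightarrow> bit" is eval_mpoly
  by (drule eval_mpoly_field_ideal) (simp only: eval_mpoly_diff right_minus_eq)

lift_definition scale :: "bit \<Rightarrow> 'v bpoly \<Rightarrow> 'v bpoly" is "\<lambda>c p. Poly_Mapping.single 0 c * p"
  by (simp add: field_ideal_def ring_module.span_scale flip: right_diff_distrib)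

global_interpretation bpoly_space: vector_space "scale :: bit \<Rightarrow> 'v bpoly \<Rightarrow> 'v bpoly"
  defines span2 = bpoly_space.span
proof unfold_locales
  have zero [simp]: "(0 :: 'v mpoly) \<in> field_ideal"
    using ring_module.span_zero by (simp add: field_ideal_def)
  fix a b :: bit and x y :: "'v bpoly"
  show "scale a (x + y) = scale a x + scale a y"
    by transfer (simp add: distrib_left)
  show "scale (a + b) x = scale a x + scale b x"
    by transfer (simp only: single_add distrib_right diff_self zero)
  show "scale a (scale b x) = scale (a * b) x"
    by transfer (simp add: mult_single flip: mult.assoc)
  show "scale 1 x = x"
    by transfer simp
qed

definition linear_bpolys :: "'v bpoly set" where
  "linear_bpolys = span2 (insert 1 (range var))"

definition sqfree_trm :: "'v trm \<Rightarrow> bool" where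
  "sqfree_trm t \<longleftrightarrow> (\<forall>v. Poly_Mapping.lookup t v \<le> 1)"

definition canonical_rep :: "'v bpoly \<Rightarrow> 'v mpoly" where
  "canonical_rep f = (THE p. residue p = f \<and> (\<forall>t\<in>Poly_Mapping.keys p. sqfree_trm t))"

definition Supp :: "'v bpoly \<Rightarrow> 'v trm set" where
  "Supp f = Poly_Mapping.keys (canonical_rep f)"


section \<open>Term orderings, leading terms and normal remainders\<close>

text \<open>\<open>(s, t) \<in> \<sigma>\<close> means that \<open>s\<close> is at most \<open>t\<close>.\<close>

definition term_ordering :: "'v trm rel \<Rightarrow> bool" where
  "term_ordering \<sigma> \<longleftrightarrow> linear_order \<sigma> \<and> (\<forall>t. (0, t) \<in> \<sigma>)
     \<and> (\<forall>s t u. (s, t) \<in> \<sigma> \<longrightarrow> (s + u, t + u) \<in> \<sigma>)"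

definition max_trm :: "'v trm rel \<Rightarrow> 'v trm set \<Rightarrow> 'v trm" where
  "max_trm \<sigma> T = (THE t. t \<in> T \<and> (\<forall>s\<in>T. (s, t) \<in> \<sigma>))"

abbreviation lt_mpoly :: "'v trm rel \<Rightarrow> 'v mpoly \<Rightarrow> 'v trm" where
  "lt_mpoly \<sigma> p \<equiv> max_trm \<sigma> (Poly_Mapping.keys p)"

text \<open>Only meaningful for nonzero \<open>f\<close>: the zero polynomial has no leading term.\<close>

definition LT :: "'v trm rel \<Rightarrow> 'v bpoly \<Rightarrow> 'v trm" where
  "LT \<sigma> f = max_trm \<sigma> (Supp f)"

definition distinct_LTs :: "'v trm rel \<Rightarrow> 'v bpoly set \<Rightarrow> bool" where
  "distinct_LTs \<sigma> L \<longleftrightarrow> 0 \<notin> L \<and> inj_on (LT \<sigma>) L"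

text \<open>
  \<open>division \<sigma> D p r q\<close>: the division algorithm with divisors \<open>D\<close>, when the current dividend is
  \<open>p\<close> and the terms collected so far add up to \<open>r\<close>, can end with the remainder \<open>q\<close>. All
  nonzero coefficients are \<open>1\<close>, so a leading monomial is a leading term.
\<close>

inductive division :: "'v trm rel \<Rightarrow> 'v mpoly set \<Rightarrow> 'v mpoly \<Rightarrow> 'v mpoly \<Rightarrow> 'v mpoly \<Rightarrow> bool"
  for \<sigma> D where
  finish: "division \<sigma> D 0 r r"
| reduce: "\<lbrakk>p \<noteq> 0; d \<in> D; d \<noteq> 0; lt_mpoly \<sigma> p = t + lt_mpoly \<sigma> d;
     division \<sigma> D (p - Poly_Mapping.single t 1 * d) r q\<rbrakk> \<Longrightarrow> division \<sigma> D p r q"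
| collect: "\<lbrakk>p \<noteq> 0; \<And>d t. d \<in> D \<Longrightarrow> d \<noteq> 0 \<Longrightarrow> lt_mpoly \<sigma> p \<noteq> t + lt_mpoly \<sigma> d;
     division \<sigma> D (p - Poly_Mapping.single (lt_mpoly \<sigma> p) 1)
       (r + Poly_Mapping.single (lt_mpoly \<sigma> p) 1) q\<rbrakk> \<Longrightarrow> division \<sigma> D p r q"

text \<open>
  If several divisors are applicable, the division algorithm picks one of them. The remainder can
  depend on these picks, and \<open>SOME\<close> fixes one run; for linear polynomials and divisors with
  pairwise distinct leading terms, all runs give the same remainder.
\<close>

definition NR :: "'v trm rel \<Rightarrow> 'v bpoly \<Rightarrow> 'v bpoly set \<Rightarrow> 'v bpoly" where
  "NR \<sigma> f L = residue (SOME q. division \<sigma> (canonical_rep ` L) (canonical_rep f) 0 q)"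


section \<open>Formulas in 2-XNF and their ideals\<close>

datatype 'v literal = Pos 'v | Neg 'v

type_synonym 'v lineral = "'v literal list"
type_synonym 'v clause = "'v lineral list"
type_synonym 'v xnf = "'v clause list"

fun literal_value :: "('v \<Rightarrow> bit) \<Rightarrow> 'v literal \<Rightarrow> bit" where
  "literal_value a (Pos v) = a v"
| "literal_value a (Neg v) = 1 + a v"

definition lineral_value :: "('v \<Rightarrow> bit) \<Rightarrow> 'v lineral \<Rightarrow> bit" where
  "lineral_value a l = (\<Sum>x\<leftarrow>l. literal_value a x)"

definition satisfies :: "('v \<Rightarrow> bit) \<Rightarrow> 'v xnf \<Rightarrow> bool" where
  "satisfies a F \<longleftrightarrow> (\<forall>C\<in>set F. \<exists>l\<in>set C. lineral_value a l = 1)"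

definition in_2XNF :: "'v xnf \<Rightarrow> bool" where
  "in_2XNF F \<longleftrightarrow> (\<forall>C\<in>set F. length C \<le> 2)"

definition zero_set :: "'v bpoly set \<Rightarrow> ('v \<Rightarrow> bit) set" where
  "zero_set I = {a. \<forall>f\<in>I. eval_bpoly a f = 0}"

definition formula_ideal :: "'v xnf \<Rightarrow> 'v bpoly set" where
  "formula_ideal F = (THE I. is_ideal I \<and> zero_set I = {a. satisfies a F})"


section \<open>Implication graph structures\<close>

type_synonym 'v igs = "'v bpoly set \<times> 'v bpoly set \<times> ('v bpoly \<times> 'v bpoly) set"

definition ideal_sum :: "'a::comm_ring_1 set \<Rightarrow> 'a set \<Rightarrow> 'a set" where
  "ideal_sum I J = {f + g | f g. f \<in> I \<and> g \<in> J}"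

fun is_igs :: "'v xnf \<Rightarrow> 'v igs \<Rightarrow> bool" where
  "is_igs F (L, V, E) \<longleftrightarrow>
     L \<subseteq> linear_bpolys \<and> V \<subseteq> linear_bpolys \<and> E \<subseteq> V \<times> V \<and>
     formula_ideal F = ideal_sum (ideal_gen L) (ideal_gen {f * g | f g. (f + 1, g) \<in> E}) \<and>
     (\<forall>f g. (f + 1, g) \<in> E \<longrightarrow> (g + 1, f) \<in> E) \<and>
     (\<forall>f\<in>V. (f, f) \<notin> E)"

fun sigma_reduced :: "'v trm rel \<Rightarrow> 'v igs \<Rightarrow> bool" where
  "sigma_reduced \<sigma> (L, V, E) \<longleftrightarrow> distinct_LTs \<sigma> L \<and> LT \<sigma> ` L \<inter> (\<Union>f\<in>V. Supp f) = {}"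

fun igs_preceq :: "'v igs \<Rightarrow> 'v igs \<Rightarrow> bool"  (infix "\<preceq>" 50) where
  "(L', V', E') \<preceq> (L, V, E) \<longleftrightarrow> span2 L \<subseteq> span2 L' \<and> card V' \<le> card V"


section \<open>The procedure GGCP\<close>

definition LT_interreduction :: "'v trm rel \<Rightarrow> 'v bpoly set \<Rightarrow> 'v bpoly set \<Rightarrow> bool" where
  "LT_interreduction \<sigma> L M \<longleftrightarrow> span2 M = span2 L \<and> distinct_LTs \<sigma> M"

text \<open>The body of the loop over the edges; \<open>L\<close> is fixed during the loop.\<close>

definition process_edge ::
    "'v trm rel \<Rightarrow> 'v bpoly set \<Rightarrow> 'v bpoly \<times> 'v bpoly \<Rightarrow> 'v igs \<Rightarrow> 'v igs" where
  "process_edge \<sigma> L = (\<lambda>(f, g) (L', V', E').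
     let f' = NR \<sigma> f L;
         g' = NR \<sigma> g L;
         L' = (if f' = 0 \<and> g' \<noteq> 0 then insert g' L' else L');
         L' = (if g' = 1 \<and> f' \<noteq> 1 then insert (f' + 1) L' else L')
     in if f' \<notin> {0, 1} \<and> g' \<notin> {0, 1} \<and> f' \<noteq> g'
        then (L', insert f' (insert g' V'), insert (f', g') E')
        else (L', V', E'))"

text \<open>
  The states of an execution: about to interreduce, about to initialise \<open>(L', V', E')\<close>, in the
  loop (with current \<open>G\<close>, set of edges still to be processed, and current \<open>(L', V', E')\<close>), and
  terminated. Choices left open by the procedure (the interreduced generating set, the order in
  which the edges are visited) are nondeterministic.

  If \<open>L\<close> has changed, the next round starts with interreducing the new \<open>L\<close>. Without this,
  two polynomials with the same leading term may have been appended and would remain in the output: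
  with \<open>x > y\<close>, \<open>L = {}\<close> and \<open>E = {(0, x), (x + 1, 1), (0, x + y), (x + y + 1, 1)}\<close>, the output
  would be \<open>({x, x + y}, {}, {})\<close>.
\<close>

datatype 'v state =
    Interreduce "'v igs"
  | Initialise "'v igs"
  | Loop "'v igs" "('v bpoly \<times> 'v bpoly) set" "'v igs"
  | Return "'v igs"

inductive ggcp_step :: "'v trm rel \<Rightarrow> 'v state \<Rightarrow> 'v state \<Rightarrow> bool" for \<sigma> where
  interreduce: "LT_interreduction \<sigma> L M \<Longrightarrow>
     ggcp_step \<sigma> (Interreduce (L, V, E)) (Initialise (M, V, E))"
| initialise: "ggcp_step \<sigma> (Initialise (L, V, E)) (Loop (L, V, E) E (L, {}, {}))"
| edge: "e \<in> R \<Longrightarrow>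
     ggcp_step \<sigma> (Loop (L, V, E) R G') (Loop (L, V, E) (R - {e}) (process_edge \<sigma> L e G'))"
| repeat: "L \<noteq> L' \<Longrightarrow>
     ggcp_step \<sigma> (Loop (L, V, E) {} (L', V', E')) (Interreduce (L', V', E'))"
| return: "L = L' \<Longrightarrow>
     ggcp_step \<sigma> (Loop (L, V, E) {} (L', V', E')) (Return (L', V', E'))"

definition ggcp_returns :: "'v trm rel \<Rightarrow> 'v igs \<Rightarrow> 'v igs \<Rightarrow> bool" where
  "ggcp_returns \<sigma> G G' \<longleftrightarrow> (ggcp_step \<sigma>)\<^sup>*\<^sup>* (Interreduce G) (Return G')"

text \<open>No execution is infinite, and none gets stuck before returning a result.\<close>

definition ggcp_terminates :: "'v trm rel \<Rightarrow> 'v igs \<Rightarrow> bool" where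
  "ggcp_terminates \<sigma> G \<longleftrightarrow>
     (\<nexists>s. s 0 = Interreduce G \<and> (\<forall>i. ggcp_step \<sigma> (s i) (s (Suc i)))) \<and>
     (\<forall>s. (ggcp_step \<sigma>)\<^sup>*\<^sup>* (Interreduce G) s \<longrightarrow> (\<exists>G'. s = Return G') \<or> (\<exists>s'. ggcp_step \<sigma> s s'))"

end

theory Submission
  imports Defs
begin

text \<open>
  If \<open>1 \<in> L\<close>, every normal remainder is \<open>0\<close> and the round returns \<open>(L, {}, {})\<close>. Otherwise
  division of a linear polynomial \<open>f\<close> by \<open>L\<close> is Gaussian elimination: the remainder is the only
  linear polynomial congruent to \<open>f\<close> modulo the span of \<open>L\<close> whose support avoids the leading terms
  of \<open>L\<close>. Hence taking remainders commutes with adding \<open>1\<close>, which keeps the edge relation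
  skew-symmetric. In both cases an edge \<open>(f, g)\<close> with remainders \<open>(f', g')\<close> satisfies
  \<open>(f + 1) g \<equiv> (f' + 1) g'\<close> modulo the ideal of \<open>L\<close>, and the degenerate cases are exactly those
  where the right-hand side is zero or linear, so every round preserves the ideal. A linear
  polynomial appended to \<open>L\<close> is nonzero and reduced, hence outside the span of \<open>L\<close>; the span grows
  strictly, which bounds the number of rounds.
\<close>

section \<open>Linear Boolean polynomials and their supports\<close>

text \<open>The possible support terms of a linear polynomial; in additive notation \<open>0\<close>
  is the term 1.\<close>

definition lin_trms :: "'v trm set" where
  "lin_trms = insert 0 (range (\<lambda>v. Poly_Mapping.single v 1))"

lemma finite_lin_trms [simp]: "finite (lin_trms :: 'v::finite trm set)"
  by (simp add: lin_trms_def)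

lemma sqfree_lin_trms: "t \<in> lin_trms \<Longrightarrow> sqfree_trm t"
  by (auto simp: lin_trms_def sqfree_trm_def lookup_single when_def)

text \<open>A product of two nontrivial terms has degree at least 2. So when one linear leading term
  divides another, the cofactor or the divisor is trivial.\<close>

lemma lin_trms_add_cases:
  assumes "s + t \<in> lin_trms"
  shows "s = 0 \<or> t = 0"
proof (rule ccontr)
  assume "\<not> ?thesis"
  then obtain u v where u: "Poly_Mapping.lookup s u > 0" and v: "Poly_Mapping.lookup t v > 0"
    by (metis gr0I lookup_zero poly_mapping_eqI)
  have "Poly_Mapping.lookup (s + t) u > 0" "Poly_Mapping.lookup (s + t) v > 0"
    using u v by (simp_all add: lookup_add)
  moreover obtain w where "s + t = Poly_Mapping.single w 1"
    using assms \<open>Poly_Mapping.lookup (s + t) u > 0\<close> by (auto simp: lin_trms_def)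
  ultimately have "u = w" "v = w" and "Poly_Mapping.lookup (s + t) w = 1"
    by (auto simp: lookup_single when_def split: if_splits)
  with u v show False by (simp add: lookup_add)
qed

section \<open>Arithmetic over F_2, where a polynomial is its set of terms\<close>

lemma keys_mpoly_eqI:
  assumes "Poly_Mapping.keys p = Poly_Mapping.keys q"
  shows "p = (q :: 'v mpoly)"
proof (rule poly_mapping_eqI)
  fix t
  show "Poly_Mapping.lookup p t = Poly_Mapping.lookup q t"
    using assms by (cases "t \<in> Poly_Mapping.keys p") (auto simp: in_keys_iff)
qed

lemma keys_mpoly_add:
  "Poly_Mapping.keys (p + q :: 'v mpoly) =
     (Poly_Mapping.keys p - Poly_Mapping.keys q) \<union> (Poly_Mapping.keys q - Poly_Mapping.keys p)"
  by (auto simp: in_keys_iff lookup_add)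

lemma mpoly_add_self: "p + p = (0 :: 'v mpoly)"
  by (rule keys_mpoly_eqI) (simp only: keys_mpoly_add, simp)

lemma mpoly_diff_eq_add: "p - q = p + (q :: 'v mpoly)"
  by (simp only: diff_eq_eq add.assoc mpoly_add_self add_0_right)

lemma bpoly_add_self [simp]: "f + f = (0 :: 'v bpoly)"
  by transfer (simp only: mpoly_add_self diff_self field_ideal_def ring_module.span_zero)

lemma bpoly_add_add_cancel [simp]: "f + (f + g) = (g :: 'v bpoly)" "f + g + g = f"
  by (simp_all add: add.assoc flip: add.assoc[of f f])

lemma bpoly_add_eq_0_iff: "f + g = 0 \<longleftrightarrow> f = (g :: 'v bpoly)"
  by (metis bpoly_add_self bpoly_add_add_cancel(1) add_0_right)

lemma residue_eq_iff: "residue p = residue q \<longleftrightarrow> p - q \<in> field_ideal"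
  by (rule bpoly.abs_eq_iff)

lemma residue_add: "residue (p + q) = residue p + residue q"
  by (simp add: plus_bpoly.abs_eq)

lemma residue_0: "residue 0 = 0"
  by (simp add: zero_bpoly_def)

lemma residue_1: "residue 1 = 1"
  by (simp add: one_bpoly_def)

lemma scale_bit: "scale c f = (if c = 0 then 0 else f)"
  by (cases c rule: bit.exhaust) simp_all

lemma span2_subset_ideal_gen: "span2 L \<subseteq> ideal_gen L"
  by (rule bpoly_space.span_minimal)
    (auto simp: bpoly_space.subspace_def scale_bit intro: ring_module.span_base ring_module.span_zero ring_module.span_add)

text \<open>A nonzero square-free polynomial does not vanish at the indicator of a minimal support term.\<close>

lemma sqfree_eval_nonzero:
  fixes p :: "'v mpoly"
  assumes sqf: "\<And>t. t \<in> Poly_Mapping.keys p \<Longrightarrow> sqfree_trm t" and "p \<noteq> 0"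
  shows "\<exists>a. eval_mpoly a p \<noteq> 0"
proof -
  have "Poly_Mapping.keys p \<noteq> {}" using \<open>p \<noteq> 0\<close> by simp
  then obtain t where t: "t \<in> Poly_Mapping.keys p"
    and min: "\<And>s. s \<in> Poly_Mapping.keys p \<Longrightarrow> card (Poly_Mapping.keys t) \<le> card (Poly_Mapping.keys s)"
    using ex_has_least_nat[of "\<lambda>t. t \<in> Poly_Mapping.keys p" _ "\<lambda>t. card (Poly_Mapping.keys t)"] by blast
  define a where "a v = (if v \<in> Poly_Mapping.keys t then 1 else 0 :: bit)" for v
  have other: "eval_trm a s = 0" if s: "s \<in> Poly_Mapping.keys p" "s \<noteq> t" for s
  proof -
    \<comment> \<open>By minimality an included variable set would be equal, and square-free terms
      with the same variables coincide.\<close>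
    have "\<not> Poly_Mapping.keys s \<subseteq> Poly_Mapping.keys t"
    proof
      assume "Poly_Mapping.keys s \<subseteq> Poly_Mapping.keys t"
      with min[OF s(1)] have eq: "Poly_Mapping.keys s = Poly_Mapping.keys t"
        by (intro card_seteq) auto
      have "Poly_Mapping.lookup s v = Poly_Mapping.lookup t v" for v
      proof -
        have "Poly_Mapping.lookup s v \<le> 1" "Poly_Mapping.lookup t v \<le> 1"
          using sqf s(1) t by (auto simp: sqfree_trm_def)
        moreover have "Poly_Mapping.lookup s v = 0 \<longleftrightarrow> Poly_Mapping.lookup t v = 0"
          using eq by (metis in_keys_iff)
        ultimately show ?thesis by linarith
      qed
      with s(2) show False by (auto intro: poly_mapping_eqI)
    qed
    then obtain v where "v \<in> Poly_Mapping.keys s" "v \<notin> Poly_Mapping.keys t" by blast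
    then show ?thesis
      unfolding eval_trm_def
      by (intro prod_zero) (auto simp: a_def in_keys_iff power_0_left intro!: bexI[of _ v])
  qed
  have "eval_mpoly a p = Poly_Mapping.lookup p t * eval_trm a t"
    unfolding eval_mpoly_def using t other
    by (subst sum.remove[of _ t]) (auto intro!: sum.neutral)
  also have "eval_trm a t = 1"
    unfolding eval_trm_def by (intro prod.neutral) (simp add: a_def)
  finally show ?thesis using t by (auto simp: in_keys_iff)
qed

text \<open>Two square-free representatives differ by an element of \<open>field_ideal\<close>,
  which vanishes at every point; a nonzero square-free polynomial does not. So the
  \<open>THE\<close> in \<open>canonical_rep\<close> is well defined here.\<close>

lemma canonical_rep_residue:
  assumes "\<And>t. t \<in> Poly_Mapping.keys p \<Longrightarrow> sqfree_trm t"
  shows "canonical_rep (residue p) = p"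
  unfolding canonical_rep_def
proof (rule the_equality)
  fix q assume q: "residue q = residue p \<and> (\<forall>t\<in>Poly_Mapping.keys q. sqfree_trm t)"
  have "eval_mpoly a (q + p) = 0" for a
    using eval_mpoly_field_ideal[of "q - p" a] q by (simp add: residue_eq_iff mpoly_diff_eq_add)
  moreover have "sqfree_trm t" if "t \<in> Poly_Mapping.keys (q + p)" for t
    using that q assms by (auto simp: keys_mpoly_add)
  ultimately have "q + p = 0"
    using sqfree_eval_nonzero[of "q + p"] by blast
  then show "q = p"
    by (simp flip: mpoly_diff_eq_add)
qed (use assms in simp)

section \<open>Linear Boolean polynomials as residues of polynomials over
  \<open>lin_trms\<close>\<close>

lemma residue_linear:
  assumes "Poly_Mapping.keys p \<subseteq> lin_trms"
  shows "residue p \<in> linear_bpolys"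
  using assms
proof (induction p rule: update_induct)
  case const
  show ?case by (simp add: residue_0 linear_bpolys_def bpoly_space.span_zero)
next
  case (update p t c)
  have eq: "Poly_Mapping.update t c p = Poly_Mapping.single t c + p"
    using update(1) by (intro poly_mapping_eqI) (auto simp: lookup_update lookup_add lookup_single in_keys_iff)
  have "c = 1" using update(2) by simp
  have sub: "t \<in> lin_trms" "Poly_Mapping.keys p \<subseteq> lin_trms"
    using update.prems update(1,2) by (auto simp: eq keys_mpoly_add split: if_splits)
  from sub(1) have "residue (Poly_Mapping.single t c) \<in> insert 1 (range var)"
    by (auto simp: lin_trms_def \<open>c = 1\<close> var_def indet_def residue_1)
  with update.IH[OF sub(2)] show ?case
    unfolding eq residue_add linear_bpolys_def
    by (intro bpoly_space.span_add) (auto intro: bpoly_space.span_base)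
qed

lemma linear_bpolyE:
  assumes "f \<in> linear_bpolys"
  obtains p where "f = residue p" "Poly_Mapping.keys p \<subseteq> lin_trms"
proof -
  from assms have "\<exists>p. f = residue p \<and> Poly_Mapping.keys p \<subseteq> lin_trms"
    unfolding linear_bpolys_def
  proof (induction rule: bpoly_space.span_induct_alt)
    case base
    show ?case by (auto intro!: exI[of _ 0] simp: residue_0)
  next
    case (step c x y)
    then obtain q where q: "y = residue q" "Poly_Mapping.keys q \<subseteq> lin_trms" by blast
    obtain p where p: "x = residue p" "Poly_Mapping.keys p \<subseteq> lin_trms"
    proof -
      have "x = residue 1 \<or> (\<exists>v. x = residue (indet v))"
        using step(1) by (auto simp: residue_1 var_def)
      with that show thesis
        by (auto simp: lin_trms_def indet_def)
    qed
    show ?case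
    proof (cases "c = 0")
      case True
      with q show ?thesis by (auto simp: scale_bit)
    next
      case False
      with p q have "scale c x + y = residue (p + q) \<and> Poly_Mapping.keys (p + q) \<subseteq> lin_trms"
        by (auto simp: scale_bit residue_add keys_mpoly_add)
      then show ?thesis by blast
    qed
  qed
  with that show thesis by blast
qed

lemma canonical_rep_linear:
  assumes "f \<in> linear_bpolys"
  shows "residue (canonical_rep f) = f" "Supp f \<subseteq> lin_trms"
  using assms by (auto elim!: linear_bpolyE simp: canonical_rep_residue sqfree_lin_trms subset_iff Supp_def)

lemma Supp_residue: "Poly_Mapping.keys p \<subseteq> lin_trms \<Longrightarrow> Supp (residue p) = Poly_Mapping.keys p"
  by (auto simp: canonical_rep_residue sqfree_lin_trms subset_iff Supp_def)

lemma finite_Supp [simp]: "finite (Supp f)"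
  by (simp add: Supp_def)

lemma Supp_0 [simp]: "Supp 0 = {}"
  using Supp_residue[of 0] by (simp add: residue_0)

lemma Supp_1 [simp]: "Supp 1 = {0}"
  using Supp_residue[of 1] by (simp add: residue_1 lin_trms_def)

text \<open>A sum of polynomials over \<open>lin_trms\<close> is again one, hence already canonical,
  so only coefficients 1 + 1 cancel.\<close>

lemma Supp_add:
  assumes "f \<in> linear_bpolys" "g \<in> linear_bpolys"
  shows "Supp (f + g) = (Supp f - Supp g) \<union> (Supp g - Supp f)"
proof -
  obtain p q where "f = residue p" "Poly_Mapping.keys p \<subseteq> lin_trms"
    "g = residue q" "Poly_Mapping.keys q \<subseteq> lin_trms"
    using assms by (metis linear_bpolyE)
  moreover from this have "Poly_Mapping.keys (p + q) \<subseteq> lin_trms"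
    by (auto simp: keys_mpoly_add)
  ultimately show ?thesis
    by (simp add: Supp_residue flip: residue_add) (simp add: keys_mpoly_add)
qed

lemma Supp_add_disjoint:
  assumes "f \<in> linear_bpolys" "g \<in> linear_bpolys" "Supp f \<inter> A = {}" "Supp g \<inter> A = {}"
  shows "Supp (f + g) \<inter> A = {}"
  using assms(3,4) unfolding Supp_add[OF assms(1,2)] by blast

lemma Supp_eqD:
  assumes "f \<in> linear_bpolys" "g \<in> linear_bpolys" "Supp f = Supp g"
  shows "f = g"
  using assms canonical_rep_linear(1) by (metis Supp_def keys_mpoly_eqI)

lemma linear_bpolys_0: "0 \<in> linear_bpolys" and linear_bpolys_1: "1 \<in> linear_bpolys"
  and linear_bpolys_add: "f \<in> linear_bpolys \<Longrightarrow> g \<in> linear_bpolys \<Longrightarrow> f + g \<in> linear_bpolys"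
  unfolding linear_bpolys_def
  by (auto intro: bpoly_space.span_zero bpoly_space.span_base bpoly_space.span_add)

lemma span2_linear: "L \<subseteq> linear_bpolys \<Longrightarrow> span2 L \<subseteq> linear_bpolys"
  unfolding linear_bpolys_def by (rule bpoly_space.span_minimal) simp_all

lemma Supp_eq_empty_iff: "f \<in> linear_bpolys \<Longrightarrow> Supp f = {} \<longleftrightarrow> f = 0"
  using Supp_eqD[OF _ linear_bpolys_0] by auto

text \<open>A linear polynomial is determined by its support. This finiteness is what bounds the
  growth of the span.\<close>

lemma finite_linear_bpolys: "finite (linear_bpolys :: 'v::finite bpoly set)"
proof (rule inj_on_finite)
  show "inj_on Supp (linear_bpolys :: 'v bpoly set)"
    by (auto intro: inj_onI Supp_eqD)
  show "Supp ` linear_bpolys \<subseteq> Pow (lin_trms :: 'v trm set)"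
    using canonical_rep_linear(2) by blast
qed simp

text \<open>Squaring is additive in characteristic 2 and fixes each \<open>var v\<close> by the
  field equation. Used for edges whose two remainders coincide, where it gives
  \<open>(a + 1) * a = 0\<close>.\<close>

lemma linear_bpoly_idem:
  assumes "f \<in> linear_bpolys"
  shows "f * f = f"
  using assms unfolding linear_bpolys_def
proof (induction rule: bpoly_space.span_induct_alt)
  case (step c x y)
  have "var v * var v = var v" for v :: 'a
    unfolding var_def times_bpoly.abs_eq residue_eq_iff field_ideal_def
    by (rule ring_module.span_base) (auto simp: power2_eq_square)
  with step(1) have x: "x * x = x" by auto
  have "(x + y) * (x + y) = x * x + y * y + (x * y + x * y)"
    by (simp only: algebra_simps)
  with x step show ?case by (simp add: scale_bit)
qed simp

section \<open>Leading terms\<close>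

lemma term_ordering_linear: "term_ordering \<sigma> \<Longrightarrow> linear_order \<sigma>"
  by (simp add: term_ordering_def)

lemma linear_order_cmp:
  assumes "linear_order \<sigma>"
  shows "(s, s) \<in> \<sigma>" "(s, t) \<in> \<sigma> \<or> (t, s) \<in> \<sigma>"
    "(s, t) \<in> \<sigma> \<Longrightarrow> (t, s) \<in> \<sigma> \<Longrightarrow> s = t" "(s, t) \<in> \<sigma> \<Longrightarrow> (t, u) \<in> \<sigma> \<Longrightarrow> (s, u) \<in> \<sigma>"
proof -
  have r: "refl \<sigma>" and t: "trans \<sigma>" and a: "antisym \<sigma>" and tot: "total \<sigma>"
    using assms by (auto simp: order_on_defs)
  show refl: "(s, s) \<in> \<sigma>" using r by (simp add: refl_on_def)
  show "(s, t) \<in> \<sigma> \<or> (t, s) \<in> \<sigma>" using tot refl by (cases "s = t") (auto simp: total_on_def)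
  show "(s, t) \<in> \<sigma> \<Longrightarrow> (t, s) \<in> \<sigma> \<Longrightarrow> s = t" using a by (rule antisymD)
  show "(s, t) \<in> \<sigma> \<Longrightarrow> (t, u) \<in> \<sigma> \<Longrightarrow> (s, u) \<in> \<sigma>" using t by (rule transD)
qed

lemma max_trm_eqI:
  assumes "linear_order \<sigma>" "t \<in> T" "\<And>s. s \<in> T \<Longrightarrow> (s, t) \<in> \<sigma>"
  shows "max_trm \<sigma> T = t"
  unfolding max_trm_def using assms linear_order_cmp(3)[OF assms(1)] by (intro the_equality) auto

lemma max_trm:
  assumes "linear_order \<sigma>" "finite T" "T \<noteq> {}"
  shows "max_trm \<sigma> T \<in> T" "s \<in> T \<Longrightarrow> (s, max_trm \<sigma> T) \<in> \<sigma>"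
proof -
  note cmp = linear_order_cmp[OF assms(1)]
  have "\<exists>t\<in>T. \<forall>s\<in>T. (s, t) \<in> \<sigma>"
    using assms(2,3)
  proof (induction T rule: finite_ne_induct)
    case (singleton x)
    then show ?case using cmp(1) by simp
  next
    case (insert x T)
    then obtain t where t: "t \<in> T" "\<And>s. s \<in> T \<Longrightarrow> (s, t) \<in> \<sigma>" by blast
    show ?case
    proof (cases "(x, t) \<in> \<sigma>")
      case True
      with t show ?thesis by blast
    next
      case False
      then have "(t, x) \<in> \<sigma>" using cmp(2) by blast
      then have "(s, x) \<in> \<sigma>" if "s \<in> insert x T" for s
        using that t(2) cmp(1) cmp(4)[of s t x] by blast
      then show ?thesis by blast
    qed
  qed
  then obtain t where "t \<in> T" "\<And>s. s \<in> T \<Longrightarrow> (s, t) \<in> \<sigma>" by blast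
  with max_trm_eqI[OF assms(1) this]
  show "max_trm \<sigma> T \<in> T" "s \<in> T \<Longrightarrow> (s, max_trm \<sigma> T) \<in> \<sigma>" by auto
qed

lemma LT_in_Supp:
  assumes "linear_order \<sigma>" "f \<in> linear_bpolys" "f \<noteq> 0"
  shows "LT \<sigma> f \<in> Supp f" "s \<in> Supp f \<Longrightarrow> (s, LT \<sigma> f) \<in> \<sigma>"
  unfolding LT_def using assms max_trm[OF assms(1) finite_Supp] by (auto simp: Supp_eq_empty_iff)

lemma LT_one: "linear_order \<sigma> \<Longrightarrow> LT \<sigma> 1 = 0"
  using LT_in_Supp[OF _ linear_bpolys_1] by auto

text \<open>The term 1, written \<open>0\<close>, is the least one in a term ordering, so a leading
  term \<open>0\<close> leaves room for no other support term.\<close>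

lemma LT_eq_0_iff:
  assumes "term_ordering \<sigma>" "f \<in> linear_bpolys" "f \<noteq> 0"
  shows "LT \<sigma> f = 0 \<longleftrightarrow> f = 1"
proof
  note lin = term_ordering_linear[OF assms(1)]
  assume 0: "LT \<sigma> f = 0"
  have "s = 0" if "s \<in> Supp f" for s
    using LT_in_Supp(2)[OF lin assms(2,3) that] assms(1) 0 linear_order_cmp(3)[OF lin]
    by (auto simp: term_ordering_def)
  with LT_in_Supp(1)[OF lin assms(2,3)] 0 have "Supp f = Supp 1" by auto
  then show "f = 1" by (rule Supp_eqD[OF assms(2) linear_bpolys_1])
qed (use assms LT_one term_ordering_linear in blast)

text \<open>The larger of the two leading terms occurs in only one summand and cannot
  cancel.\<close>

lemma LT_add:
  assumes lin: "linear_order \<sigma>" and f: "f \<in> linear_bpolys" "f \<noteq> 0" and g: "g \<in> linear_bpolys" "g \<noteq> 0"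
    and neq: "LT \<sigma> f \<noteq> LT \<sigma> g"
  shows "f + g \<noteq> 0" "LT \<sigma> (f + g) \<in> {LT \<sigma> f, LT \<sigma> g}"
proof -
  note cmp = linear_order_cmp[OF lin]
  show "f + g \<noteq> 0" using neq by (auto simp: bpoly_add_eq_0_iff)
  have *: "LT \<sigma> (f + g) = LT \<sigma> g"
    if "f \<in> linear_bpolys" "f \<noteq> 0" "g \<in> linear_bpolys" "g \<noteq> 0" "(LT \<sigma> f, LT \<sigma> g) \<in> \<sigma>" "LT \<sigma> f \<noteq> LT \<sigma> g" for f g
  proof -
    have "LT \<sigma> g \<notin> Supp f" using LT_in_Supp(2)[OF lin that(1,2)] that(5,6) cmp(3) by blast
    moreover have "(s, LT \<sigma> g) \<in> \<sigma>" if "s \<in> Supp f \<or> s \<in> Supp g" for s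
      using that LT_in_Supp(2)[OF lin] \<open>f \<in> _\<close> \<open>g \<in> _\<close> \<open>f \<noteq> 0\<close> \<open>g \<noteq> 0\<close> \<open>(LT \<sigma> f, LT \<sigma> g) \<in> \<sigma>\<close> cmp(4) by blast
    ultimately show ?thesis
      unfolding LT_def[of _ "f + g"]
      using LT_in_Supp(1)[OF lin that(3,4)] by (intro max_trm_eqI[OF lin]) (auto simp: Supp_add that)
  qed
  show "LT \<sigma> (f + g) \<in> {LT \<sigma> f, LT \<sigma> g}"
    using *[OF f g] *[OF g f] neq cmp(2)[of "LT \<sigma> f" "LT \<sigma> g"] by (auto simp: add.commute)
qed

section \<open>Spans over F_2 and elimination of leading terms\<close>

lemma span2_explicit:
  "f \<in> span2 L \<Longrightarrow> \<exists>S. finite S \<and> S \<subseteq> L \<and> f = \<Sum>S"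
proof (induction rule: bpoly_space.span_induct_alt)
  case base
  show ?case by (rule exI[of _ "{}"]) simp
next
  case (step c x y)
  then obtain S where S: "finite S" "S \<subseteq> L" "y = \<Sum>S" by blast
  show ?case
  proof (cases "c = 0")
    case True
    with S show ?thesis by (auto simp: scale_bit)
  next
    case False
    then have c: "scale c x + y = x + y" by (simp add: scale_bit)
    show ?thesis
    proof (cases "x \<in> S")
      case True
      \<comment> \<open>A generator already present cancels in characteristic 2, so subset sums
        suffice.\<close>
      with S have "x + y = \<Sum>(S - {x})" by (simp add: sum.remove)
      then show ?thesis unfolding c using S by (intro exI[of _ "S - {x}"]) auto
    next
      case False
      with S have "x + y = \<Sum>(insert x S)" by simp
      then show ?thesis unfolding c using S step(1) by (intro exI[of _ "insert x S"]) auto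
    qed
  qed
qed

lemma span2_sub_linear: "L \<subseteq> linear_bpolys \<Longrightarrow> f \<in> span2 L \<Longrightarrow> f \<in> linear_bpolys"
  using span2_linear by blast

text \<open>Distinct leading terms cannot cancel: by induction every nonempty subset sum is nonzero
  and inherits the leading term of a summand.\<close>

lemma LT_span2:
  assumes lin: "linear_order \<sigma>" and L: "L \<subseteq> linear_bpolys" "distinct_LTs \<sigma> L"
    and f: "f \<in> span2 L" "f \<noteq> 0"
  shows "LT \<sigma> f \<in> LT \<sigma> ` L"
proof -
  have *: "S \<noteq> {} \<longrightarrow> \<Sum>S \<noteq> 0 \<and> LT \<sigma> (\<Sum>S) \<in> LT \<sigma> ` S" if "finite S" "S \<subseteq> L" for S
    using that
  proof (induction S rule: finite_induct)
    case (insert x S)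
    have x: "x \<in> linear_bpolys" "x \<noteq> 0" using insert.prems L by (auto simp: distinct_LTs_def)
    have S: "\<Sum>S \<in> linear_bpolys"
      using insert.prems by (intro span2_sub_linear[OF L(1)] bpoly_space.span_sum bpoly_space.span_base) auto
    show ?case
    proof (cases "S = {}")
      case False
      with insert have IH: "\<Sum>S \<noteq> 0" "LT \<sigma> (\<Sum>S) \<in> LT \<sigma> ` S" by auto
      moreover have "LT \<sigma> x \<notin> LT \<sigma> ` S"
        using insert.hyps(2) insert.prems L(2) by (auto simp: distinct_LTs_def inj_on_def)
      ultimately have "LT \<sigma> x \<noteq> LT \<sigma> (\<Sum>S)" by auto
      from LT_add[OF lin x S IH(1) this] IH(2) insert.hyps show ?thesis by auto
    qed (use x in simp)
  qed simp
  obtain S where "finite S" "S \<subseteq> L" "f = \<Sum>S" using span2_explicit[OF f(1)] by blast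
  with *[of S] f(2) show ?thesis by auto
qed

text \<open>Otherwise the leading term of \<open>f\<close> would be one of \<open>L\<close> lying in
  \<open>Supp f\<close>. Applied to the difference of two remainders this is uniqueness; applied to
  an appended polynomial it shows that the span grows.\<close>

lemma reduced_in_span2_eq_0:
  assumes "linear_order \<sigma>" "L \<subseteq> linear_bpolys" "distinct_LTs \<sigma> L"
    and "f \<in> span2 L" "Supp f \<inter> LT \<sigma> ` L = {}"
  shows "f = 0"
  using LT_span2[OF assms(1-4)] LT_in_Supp(1)[OF assms(1) span2_sub_linear[OF assms(2,4)]] assms(5) by auto

text \<open>Termination measure for the elimination of leading terms.\<close>

definition rank :: "'v trm rel \<Rightarrow> 'v trm set \<Rightarrow> nat" where
  "rank \<sigma> T = card {s \<in> lin_trms. \<exists>k\<in>T. (s, k) \<in> \<sigma>}"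

text \<open>\<open>m\<close> is counted for \<open>T\<close> but is below nothing in
  \<open>T'\<close>, while all that is below \<open>T'\<close> is below \<open>m\<close>.\<close>

lemma rank_less:
  fixes T :: "'v::finite trm set"
  assumes lin: "linear_order \<sigma>" and "T \<subseteq> lin_trms" "m \<in> T"
    and T': "\<And>k. k \<in> T' \<Longrightarrow> (k, m) \<in> \<sigma> \<and> k \<noteq> m"
  shows "rank \<sigma> T' < rank \<sigma> T"
  unfolding rank_def
proof (rule psubset_card_mono)
  note cmp = linear_order_cmp[OF lin]
  have "\<And>k. k \<in> T' \<Longrightarrow> (m, k) \<notin> \<sigma>" using T' cmp(3) by blast
  then show "{s \<in> lin_trms. \<exists>k\<in>T'. (s, k) \<in> \<sigma>} \<subset> {s \<in> lin_trms. \<exists>k\<in>T. (s, k) \<in> \<sigma>}"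
    using assms(2-4) cmp(1,4) by blast
qed simp

text \<open>One elimination step on supports: the common maximum cancels and all other terms are
  smaller.\<close>

lemma rank_add_less:
  fixes T :: "'v::finite trm set"
  assumes "linear_order \<sigma>" "T \<subseteq> lin_trms" "finite T" "T \<noteq> {}" "finite U" "U \<noteq> {}"
    and "max_trm \<sigma> T = max_trm \<sigma> U"
  shows "rank \<sigma> ((T - U) \<union> (U - T)) < rank \<sigma> T"
proof (rule rank_less[OF assms(1,2)])
  show "max_trm \<sigma> T \<in> T" using max_trm(1) assms by blast
  fix k assume "k \<in> (T - U) \<union> (U - T)"
  then show "(k, max_trm \<sigma> T) \<in> \<sigma> \<and> k \<noteq> max_trm \<sigma> T"
    using max_trm[OF assms(1,3,4)] max_trm[OF assms(1,5,6)] assms(7) by auto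
qed

text \<open>One span element for each leading term occurring in the span already generates the span;
  \<open>h\<close> makes this choice.\<close>

lemma LT_interreduction_exists:
  fixes L :: "'v::finite bpoly set"
  assumes lin: "linear_order \<sigma>" and L: "L \<subseteq> linear_bpolys"
  shows "\<exists>M. LT_interreduction \<sigma> L M"
proof -
  define U where "U = span2 L - {0}"
  have U: "f \<in> linear_bpolys" "f \<noteq> 0" if "f \<in> U" for f
    using that span2_sub_linear[OF L] by (auto simp: U_def)
  define h where "h = inv_into U (LT \<sigma>)"
  have h: "h (LT \<sigma> f) \<in> U" "LT \<sigma> (h (LT \<sigma> f)) = LT \<sigma> f" if "f \<in> U" for f
    unfolding h_def using that by (auto intro: inv_into_into f_inv_into_f)
  define M where "M = h ` LT \<sigma> ` U"
  have MU: "M \<subseteq> U" using h by (auto simp: M_def)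
  have "span2 M \<subseteq> span2 L"
    by (rule bpoly_space.span_minimal) (use MU in \<open>auto simp: U_def\<close>)
  moreover have "f \<in> span2 M" if "f \<in> span2 L" for f
    using that
  \<comment> \<open>Adding the element of \<open>M\<close> with the leading term of \<open>f\<close>
    lowers the rank.\<close>
  proof (induction "rank \<sigma> (Supp f)" arbitrary: f rule: less_induct)
    case less
    show ?case
    proof (cases "f = 0")
      case False
      with less.prems have fU: "f \<in> U" by (simp add: U_def)
      let ?g = "h (LT \<sigma> f)"
      note gU = h(1)[OF fU]
      have "?g + f \<in> span2 L"
        using gU less.prems by (simp add: U_def bpoly_space.span_add)
      moreover have "rank \<sigma> (Supp (?g + f)) < rank \<sigma> (Supp f)"
        using rank_add_less[OF lin canonical_rep_linear(2)[OF U(1)[OF fU]], of "Supp ?g"] h(2)[OF fU] U[OF fU] U[OF gU]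
        by (simp add: Supp_add Supp_eq_empty_iff Un_commute flip: LT_def)
      ultimately have "?g + f \<in> span2 M" using less.hyps by blast
      moreover have "?g \<in> span2 M" using fU by (auto simp: M_def intro: bpoly_space.span_base)
      ultimately have "?g + (?g + f) \<in> span2 M" by (rule bpoly_space.span_add[rotated])
      then show ?thesis by simp
    qed (simp add: bpoly_space.span_zero)
  qed
  moreover have "distinct_LTs \<sigma> M"
    unfolding distinct_LTs_def using MU h by (auto simp: M_def U_def inj_on_def)
  ultimately show ?thesis by (auto simp: LT_interreduction_def)
qed

section \<open>Normal remainders of linear polynomials\<close>

lemma lt_mpoly_linear: "Poly_Mapping.keys p \<subseteq> lin_trms \<Longrightarrow> lt_mpoly \<sigma> p = LT \<sigma> (residue p)"
  by (simp add: LT_def Supp_residue)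

text \<open>The leading term of \<open>p\<close> is 1 or an indeterminate, so it factors only
  trivially; a divisor with leading term 1 is the constant 1.\<close>

lemma reduce_cases:
  assumes ord: "term_ordering \<sigma>"
    and p: "Poly_Mapping.keys p \<subseteq> lin_trms" "p \<noteq> 0" and d: "Poly_Mapping.keys d \<subseteq> lin_trms" "d \<noteq> 0"
    and lt: "lt_mpoly \<sigma> p = t + lt_mpoly \<sigma> d"
  shows "t = 0 \<or> d = 1 \<and> t = lt_mpoly \<sigma> p"
proof (rule disjCI)
  note lin = term_ordering_linear[OF ord]
  assume "\<not> (d = 1 \<and> t = lt_mpoly \<sigma> p)"
  have "lt_mpoly \<sigma> p \<in> lin_trms"
    using max_trm(1)[OF lin, of "Poly_Mapping.keys p"] p by auto
  then have "t = 0 \<or> lt_mpoly \<sigma> d = 0"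
    using lt lin_trms_add_cases by metis
  moreover have "d = 1" if "lt_mpoly \<sigma> d = 0"
  proof -
    have "residue d \<in> linear_bpolys" using d(1) by (rule residue_linear)
    moreover have "residue d \<noteq> 0" using d by (metis Supp_0 Supp_residue keys_eq_empty)
    moreover have "LT \<sigma> (residue d) = 0" using that d(1) by (simp add: lt_mpoly_linear)
    ultimately have "residue d = residue 1" using LT_eq_0_iff[OF ord] by (simp add: residue_1)
    then show ?thesis
      using d(1) by (metis Supp_1 Supp_residue keys_mpoly_eqI keys_one residue_1)
  qed
  ultimately show "t = 0" using lt \<open>\<not> (d = 1 \<and> t = lt_mpoly \<sigma> p)\<close> by (metis add.right_neutral)
qed

text \<open>The subtrahend is \<open>d\<close> itself or, for \<open>d = 1\<close>, the leading term
  of \<open>p\<close>. So a reduction stays linear and lowers the rank.\<close>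

lemma reduce_step:
  assumes ord: "term_ordering \<sigma>"
    and p: "Poly_Mapping.keys p \<subseteq> lin_trms" "p \<noteq> 0" and d: "Poly_Mapping.keys d \<subseteq> lin_trms" "d \<noteq> 0"
    and lt: "lt_mpoly \<sigma> p = t + lt_mpoly \<sigma> d"
  defines "x \<equiv> Poly_Mapping.single t 1 * d"
  shows "Poly_Mapping.keys x \<subseteq> lin_trms" "x \<noteq> 0" "lt_mpoly \<sigma> p = lt_mpoly \<sigma> x"
proof -
  note lin = term_ordering_linear[OF ord]
  have "lt_mpoly \<sigma> p \<in> lin_trms"
    using max_trm(1)[OF lin, of "Poly_Mapping.keys p"] p by auto
  moreover have "lt_mpoly \<sigma> (Poly_Mapping.single s (1::bit)) = s" for s
    by (rule max_trm_eqI[OF lin]) (auto intro: linear_order_cmp(1)[OF lin])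
  moreover have "Poly_Mapping.single s (1::bit) \<noteq> 0" for s :: "'a trm"
    by (simp flip: keys_eq_empty)
  ultimately show "Poly_Mapping.keys x \<subseteq> lin_trms" "x \<noteq> 0" "lt_mpoly \<sigma> p = lt_mpoly \<sigma> x"
    using reduce_cases[OF ord p d lt] d lt by (auto simp: x_def)
qed

text \<open>This makes the \<open>SOME\<close> in \<open>NR\<close> meaningful. Every division step
  cancels the leading term of the dividend, so the rank decreases.\<close>

lemma division_exists:
  fixes p :: "'v::finite mpoly"
  assumes ord: "term_ordering \<sigma>" and p: "Poly_Mapping.keys p \<subseteq> lin_trms"
    and D: "\<And>d. d \<in> D \<Longrightarrow> Poly_Mapping.keys d \<subseteq> lin_trms"
  shows "\<exists>q. division \<sigma> D p r q"
  using p
proof (induction "rank \<sigma> (Poly_Mapping.keys p)" arbitrary: p r rule: less_induct)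
  case less
  note lin = term_ordering_linear[OF ord]
  \<comment> \<open>Common to reducing and collecting: \<open>x\<close> is whatever cancels the
    leading term.\<close>
  have step: "\<exists>q. division \<sigma> D (p - x) r' q"
    if "p \<noteq> 0" "Poly_Mapping.keys x \<subseteq> lin_trms" "x \<noteq> 0" "lt_mpoly \<sigma> p = lt_mpoly \<sigma> x" for x r'
  proof (rule less.hyps)
    show "rank \<sigma> (Poly_Mapping.keys (p - x)) < rank \<sigma> (Poly_Mapping.keys p)"
      unfolding mpoly_diff_eq_add keys_mpoly_add
      by (rule rank_add_less[OF lin less.prems]) (use that in auto)
    show "Poly_Mapping.keys (p - x) \<subseteq> lin_trms"
      using less.prems that by (auto simp: mpoly_diff_eq_add keys_mpoly_add)
  qed
  consider "p = 0" | d t where "p \<noteq> 0" "d \<in> D" "d \<noteq> 0" "lt_mpoly \<sigma> p = t + lt_mpoly \<sigma> d"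
    | "p \<noteq> 0" "\<And>d t. d \<in> D \<Longrightarrow> d \<noteq> 0 \<Longrightarrow> lt_mpoly \<sigma> p \<noteq> t + lt_mpoly \<sigma> d" by blast
  then show ?case
  proof cases
    case 1
    then show ?thesis by (auto intro: division.finish)
  next
    case 2
    from step[OF 2(1) reduce_step[OF ord less.prems 2(1) D[OF 2(2)] 2(3,4)]]
    show ?thesis using division.reduce[OF 2] by blast
  next
    case 3
    let ?x = "Poly_Mapping.single (lt_mpoly \<sigma> p) (1::bit)"
    have "lt_mpoly \<sigma> p \<in> lin_trms"
      using max_trm(1)[OF lin, of "Poly_Mapping.keys p"] 3(1) less.prems by auto
    moreover have "lt_mpoly \<sigma> p = lt_mpoly \<sigma> ?x"
      by (rule max_trm_eqI[OF lin, symmetric]) (auto intro: linear_order_cmp(1)[OF lin])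
    moreover have "?x \<noteq> 0"
      by (simp flip: keys_eq_empty)
    ultimately obtain q where "division \<sigma> D (p - ?x) (r + ?x) q"
      using step[of ?x "r + ?x"] 3(1) by auto
    then show ?thesis using division.collect[OF 3] by blast
  qed
qed

text \<open>The divisor 1 has leading term \<open>0\<close>, which divides every term, so nothing is
  ever collected.\<close>

lemma division_by_one:
  assumes "division \<sigma> D p r q" "linear_order \<sigma>" "1 \<in> D"
  shows "q = r"
  using assms(1)
proof (induction rule: division.induct)
  case (collect p r q)
  have "lt_mpoly \<sigma> (1 :: 'a mpoly) = 0"
    by (rule max_trm_eqI[OF assms(2)]) (auto intro: linear_order_cmp(1)[OF assms(2)])
  with collect(2)[OF assms(3), of "lt_mpoly \<sigma> p"] show ?case by simp
qed auto

text \<open>Along a run \<open>p + r\<close> changes only by divisors, and only irreducible terms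
  are collected. Excluding the divisor 1 keeps every cofactor trivial, which gives congruence modulo
  the span and not merely the ideal.\<close>

lemma division_linear:
  assumes "division \<sigma> D p r q" and ord: "term_ordering \<sigma>"
    and D: "\<And>d. d \<in> D \<Longrightarrow> Poly_Mapping.keys d \<subseteq> lin_trms" "1 \<notin> D"
    and "Poly_Mapping.keys p \<subseteq> lin_trms" "Poly_Mapping.keys r \<subseteq> lin_trms"
    and "Poly_Mapping.keys r \<inter> lt_mpoly \<sigma> ` (D - {0}) = {}"
  shows "Poly_Mapping.keys q \<subseteq> lin_trms \<and> Poly_Mapping.keys q \<inter> lt_mpoly \<sigma> ` (D - {0}) = {} \<and>
    residue (p + r) + residue q \<in> span2 (residue ` D)"
  using assms(1,5-7)
proof (induction rule: division.induct)
  case (finish r)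
  then show ?case by (simp add: bpoly_space.span_zero)
next
  case (reduce p d t r q)
  have "t = 0"
    using reduce_cases[OF ord reduce.prems(1) reduce.hyps(1) D(1)[OF reduce.hyps(2)] reduce.hyps(3,4)]
      reduce.hyps(2) D(2) by auto
  then have x: "p - Poly_Mapping.single t 1 * d = p + d" by (simp add: mpoly_diff_eq_add)
  have "Poly_Mapping.keys (p + d) \<subseteq> lin_trms"
    using reduce.prems(1) D(1)[OF reduce.hyps(2)] by (auto simp: keys_mpoly_add)
  from reduce.IH[unfolded x, OF this reduce.prems(2,3)]
  have IH: "Poly_Mapping.keys q \<subseteq> lin_trms" "Poly_Mapping.keys q \<inter> lt_mpoly \<sigma> ` (D - {0}) = {}"
    "residue (p + d + r) + residue q \<in> span2 (residue ` D)" by auto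
  have "residue d \<in> span2 (residue ` D)" using reduce.hyps(2) by (intro bpoly_space.span_base) simp
  from bpoly_space.span_add[OF this IH(3)]
  have "residue (p + r) + residue q \<in> span2 (residue ` D)"
    by (simp only: residue_add ac_simps bpoly_add_add_cancel)
  with IH(1,2) show ?case by simp
next
  case (collect p r q)
  let ?x = "Poly_Mapping.single (lt_mpoly \<sigma> p) (1::bit)"
  have in_p: "lt_mpoly \<sigma> p \<in> Poly_Mapping.keys p"
    using max_trm(1)[OF term_ordering_linear[OF ord], of "Poly_Mapping.keys p"] collect.hyps(1) by auto
  \<comment> \<open>The irreducibility premise with cofactor \<open>0\<close>.\<close>
  have not_lt: "lt_mpoly \<sigma> p \<notin> lt_mpoly \<sigma> ` (D - {0})"
    using collect.hyps(2)[of _ 0] by auto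
  have "Poly_Mapping.keys (r + ?x) \<inter> lt_mpoly \<sigma> ` (D - {0}) \<subseteq>
      insert (lt_mpoly \<sigma> p) (Poly_Mapping.keys r) \<inter> lt_mpoly \<sigma> ` (D - {0})"
    by (rule Int_mono) (auto simp: keys_mpoly_add)
  also have "\<dots> = {}"
    using collect.prems(3) not_lt by (simp only: Int_insert_left if_False)
  finally have disj: "Poly_Mapping.keys (r + ?x) \<inter> lt_mpoly \<sigma> ` (D - {0}) = {}"
    by (rule subset_empty[THEN iffD1])
  have sub: "Poly_Mapping.keys (p - ?x) \<subseteq> lin_trms" "Poly_Mapping.keys (r + ?x) \<subseteq> lin_trms"
    using in_p collect.prems by (auto simp: mpoly_diff_eq_add keys_mpoly_add)
  have "p - ?x + (r + ?x) = p + r" by simp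
  with collect.IH[OF sub disj] show ?case by (simp only:)
qed

text \<open>With \<open>1 \<in> L\<close> nontrivial cofactors occur and congruence modulo the span
  can fail, so that case is kept apart.\<close>

lemma NR_linear:
  fixes \<sigma> :: "('v::finite) trm rel"
  assumes ord: "term_ordering \<sigma>" and f: "f \<in> linear_bpolys" and L: "L \<subseteq> linear_bpolys" "0 \<notin> L"
  shows "1 \<in> L \<Longrightarrow> NR \<sigma> f L = 0"
    and "1 \<notin> L \<Longrightarrow> NR \<sigma> f L \<in> linear_bpolys \<and> Supp (NR \<sigma> f L) \<inter> LT \<sigma> ` L = {} \<and> f + NR \<sigma> f L \<in> span2 L"
proof -
  let ?D = "canonical_rep ` L"
  define q where "q = (SOME q. division \<sigma> ?D (canonical_rep f) 0 q)"
  have NR: "NR \<sigma> f L = residue q" by (simp add: NR_def q_def)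
  have keys: "Poly_Mapping.keys (canonical_rep g) \<subseteq> lin_trms" if "g \<in> linear_bpolys" for g :: "'v bpoly"
    using canonical_rep_linear(2)[OF that] by (simp add: Supp_def)
  have D: "Poly_Mapping.keys d \<subseteq> lin_trms" if "d \<in> ?D" for d
    using that L keys by blast
  have q: "division \<sigma> ?D (canonical_rep f) 0 q"
    unfolding q_def by (rule someI_ex, rule division_exists[OF ord keys[OF f] D])
  have rep1: "canonical_rep 1 = (1 :: 'v mpoly)"
    using canonical_rep_residue[of 1] by (simp add: residue_1 sqfree_trm_def)
  show "NR \<sigma> f L = 0" if "1 \<in> L"
  proof -
    have "1 \<in> ?D" using that rep1 by (metis imageI)
    with division_by_one[OF q term_ordering_linear[OF ord]] show ?thesis
      by (simp add: NR residue_0)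
  qed
  assume "1 \<notin> L"
  have res: "residue ` ?D = L"
    unfolding image_image using L(1) by (simp add: canonical_rep_linear(1) subset_iff)
  have "1 \<notin> ?D"
  proof
    assume "1 \<in> ?D"
    then have "residue 1 \<in> L" using res by blast
    with \<open>1 \<notin> L\<close> show False by (simp add: residue_1)
  qed
  moreover have "0 \<notin> ?D"
  proof
    assume "0 \<in> ?D"
    then have "residue 0 \<in> L" using res by blast
    with L(2) show False by (simp add: residue_0)
  qed
  then have "?D - {0} = ?D" by simp
  moreover have "lt_mpoly \<sigma> ` ?D = LT \<sigma> ` L"
    by (simp add: image_image LT_def Supp_def)
  ultimately have "Poly_Mapping.keys q \<subseteq> lin_trms \<and> Poly_Mapping.keys q \<inter> LT \<sigma> ` L = {} \<and> f + residue q \<in> span2 L"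
    using division_linear[OF q ord D _ keys[OF f]] res f by (simp add: canonical_rep_linear(1))
  then show "NR \<sigma> f L \<in> linear_bpolys \<and> Supp (NR \<sigma> f L) \<inter> LT \<sigma> ` L = {} \<and> f + NR \<sigma> f L \<in> span2 L"
    unfolding NR by (auto simp: residue_linear Supp_residue)
qed

section \<open>One round of the procedure\<close>

text \<open>The accumulator of the loop once the edges \<open>P\<close> are processed, in whatever order.\<close>

definition round_igs ::
    "'v trm rel \<Rightarrow> 'v bpoly set \<Rightarrow> ('v bpoly \<times> 'v bpoly) set \<Rightarrow> 'v igs" where
  "round_igs \<sigma> L P =
    (let E' = {(NR \<sigma> f L, NR \<sigma> g L) | f g. (f, g) \<in> P}
     in (L \<union> {b. b \<noteq> 0 \<and> (0, b) \<in> E'} \<union> {a + 1 | a. a \<noteq> 1 \<and> (a, 1) \<in> E'},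
         \<Union> {{a, b} | a b. (a, b) \<in> E' \<and> a \<notin> {0, 1} \<and> b \<notin> {0, 1} \<and> a \<noteq> b},
         {(a, b). (a, b) \<in> E' \<and> a \<notin> {0, 1} \<and> b \<notin> {0, 1} \<and> a \<noteq> b}))"

lemma round_igs_empty: "round_igs \<sigma> L {} = (L, {}, {})"
  by (simp add: round_igs_def)

text \<open>Each component of \<open>round_igs\<close> collects contributions of single edges, so a
  further edge just inserts its own, under the guards of \<open>process_edge\<close>. Hence the
  order of the edges does not matter.\<close>

lemma process_edge_round_igs:
  "process_edge \<sigma> L e (round_igs \<sigma> L P) = round_igs \<sigma> L (insert e P)"
proof (cases e)
  case (Pair f g)
  define E' where "E' = {(NR \<sigma> f L, NR \<sigma> g L) | f g. (f, g) \<in> P}"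
  define a b where "a = NR \<sigma> f L" and "b = NR \<sigma> g L"
  have ins: "{(NR \<sigma> f L, NR \<sigma> g L) | f g. (f, g) \<in> insert e P} = insert (a, b) E'"
    by (auto simp: Pair E'_def a_def b_def)
  have 1: "{b'. b' \<noteq> 0 \<and> (0, b') \<in> insert (a, b) E'} =
      (if a = 0 \<and> b \<noteq> 0 then insert b {b'. b' \<noteq> 0 \<and> (0, b') \<in> E'} else {b'. b' \<noteq> 0 \<and> (0, b') \<in> E'})"
    by auto
  have 2: "{a' + 1 | a'. a' \<noteq> 1 \<and> (a', 1) \<in> insert (a, b) E'} =
      (if b = 1 \<and> a \<noteq> 1 then insert (a + 1) {a' + 1 | a'. a' \<noteq> 1 \<and> (a', 1) \<in> E'}
       else {a' + 1 | a'. a' \<noteq> 1 \<and> (a', 1) \<in> E'})"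
    by auto
  have 3: "\<Union> {{a', b'} | a' b'. (a', b') \<in> insert (a, b) E' \<and> a' \<notin> {0, 1} \<and> b' \<notin> {0, 1} \<and> a' \<noteq> b'} =
      (if a \<notin> {0, 1} \<and> b \<notin> {0, 1} \<and> a \<noteq> b
       then insert a (insert b (\<Union> {{a', b'} | a' b'. (a', b') \<in> E' \<and> a' \<notin> {0, 1} \<and> b' \<notin> {0, 1} \<and> a' \<noteq> b'}))
       else \<Union> {{a', b'} | a' b'. (a', b') \<in> E' \<and> a' \<notin> {0, 1} \<and> b' \<notin> {0, 1} \<and> a' \<noteq> b'})"
    by (simp only: insert_iff) auto
  have 4: "{(a', b'). (a', b') \<in> insert (a, b) E' \<and> a' \<notin> {0, 1} \<and> b' \<notin> {0, 1} \<and> a' \<noteq> b'} =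
      (if a \<notin> {0, 1} \<and> b \<notin> {0, 1} \<and> a \<noteq> b
       then insert (a, b) {(a', b'). (a', b') \<in> E' \<and> a' \<notin> {0, 1} \<and> b' \<notin> {0, 1} \<and> a' \<noteq> b'}
       else {(a', b'). (a', b') \<in> E' \<and> a' \<notin> {0, 1} \<and> b' \<notin> {0, 1} \<and> a' \<noteq> b'})"
    by auto
  show ?thesis
    unfolding round_igs_def ins Let_def 1 2 3 4 E'_def[symmetric]
    unfolding process_edge_def Pair Let_def a_def[symmetric] b_def[symmetric] prod.case
    by simp
qed

lemma ideal_sum_eq_Un: "ideal_sum (ideal_gen A) (ideal_gen B) = ideal_gen (A \<union> B)"
  by (simp add: ideal_sum_def ring_module.span_Un)

text \<open>Since \<open>f + 1 + 1 = f\<close>, an edge \<open>(a, b)\<close> contributes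
  \<open>(a + 1) * b\<close>: at a zero of the ideal, \<open>a = 0\<close> forces
  \<open>b = 0\<close>.\<close>

lemma edge_products:
  fixes E :: "('v bpoly \<times> 'v bpoly) set"
  shows "{f * g | f g. (f + 1, g) \<in> E} = {(a + 1) * b | a b. (a, b) \<in> E}"
proof (intro equalityI subsetI; clarify)
  fix f g assume "(f + 1, g) \<in> E"
  then show "\<exists>a b. f * g = (a + 1) * b \<and> (a, b) \<in> E"
    by (intro exI[of _ "f + 1"] exI[of _ g]) simp
next
  fix a b assume "(a, b) \<in> E"
  then show "\<exists>f g. (a + 1) * b = f * g \<and> (f + 1, g) \<in> E"
    by (intro exI[of _ "a + 1"] exI[of _ b]) simp
qed

text \<open>The situation when a loop over the edges starts, after interreduction.\<close>

locale interreduced_igs =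
  fixes \<sigma> :: "('v::finite) trm rel" and F :: "'v xnf" and L V E
  assumes ord: "term_ordering \<sigma>"
    and igs: "is_igs F (L, V, E)"
    and distinct: "distinct_LTs \<sigma> L"
begin

lemma L_linear: "L \<subseteq> linear_bpolys" and V_linear: "V \<subseteq> linear_bpolys" and EV: "E \<subseteq> V \<times> V"
  and ideal: "formula_ideal F = ideal_gen (L \<union> {(a + 1) * b | a b. (a, b) \<in> E})"
  and skew: "(f + 1, g) \<in> E \<Longrightarrow> (g + 1, f) \<in> E"
  using igs unfolding edge_products[symmetric] by (simp_all add: ideal_sum_eq_Un)

lemma NR_eq_0: "1 \<in> L \<Longrightarrow> f \<in> linear_bpolys \<Longrightarrow> NR \<sigma> f L = 0"
  using NR_linear(1)[OF ord _ L_linear] distinct by (simp add: distinct_LTs_def)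

lemma NR_reduced:
  assumes "f \<in> linear_bpolys"
  shows "NR \<sigma> f L \<in> linear_bpolys" "Supp (NR \<sigma> f L) \<inter> LT \<sigma> ` L = {}"
  using NR_linear[OF ord assms L_linear] distinct linear_bpolys_0
  by (cases "1 \<in> L"; auto simp: distinct_LTs_def)+

text \<open>Unlike congruence modulo the span, this also covers \<open>1 \<in> L\<close>, where the
  ideal is the whole ring.\<close>

lemma NR_congruent:
  assumes "f \<in> linear_bpolys"
  shows "f + NR \<sigma> f L \<in> ideal_gen L"
proof (cases "1 \<in> L")
  case True
  then have "(f + NR \<sigma> f L) * 1 \<in> ideal_gen L"
    by (intro ring_module.span_scale ring_module.span_base)
  then show ?thesis by simp
next
  case False
  then have "f + NR \<sigma> f L \<in> span2 L"
    using NR_linear(2)[OF ord assms L_linear] distinct by (simp add: distinct_LTs_def)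
  then show ?thesis using span2_subset_ideal_gen by blast
qed

text \<open>Only the constant 1 has leading term \<open>0\<close>. Hence adding 1 to a reduced
  polynomial keeps it reduced.\<close>

lemma zero_notin_LT: "1 \<notin> L \<Longrightarrow> 0 \<notin> LT \<sigma> ` L"
  using LT_eq_0_iff[OF ord] L_linear distinct by (metis distinct_LTs_def imageE subsetD)

text \<open>Both sides are reduced and congruent to \<open>f + 1\<close> modulo the span, so their
  sum is zero. For \<open>1 \<in> L\<close> all remainders are 0 and the law fails.\<close>

lemma NR_add_1:
  assumes f: "f \<in> linear_bpolys" and "1 \<notin> L"
  shows "NR \<sigma> (f + 1) L = NR \<sigma> f L + 1"
proof -
  have f1: "f + 1 \<in> linear_bpolys" using f linear_bpolys_1 linear_bpolys_add by blast
  have L0: "0 \<notin> L" using distinct by (simp add: distinct_LTs_def)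
  note A = NR_linear(2)[OF ord f L_linear L0 \<open>1 \<notin> L\<close>]
  note B = NR_linear(2)[OF ord f1 L_linear L0 \<open>1 \<notin> L\<close>]
  let ?h = "NR \<sigma> (f + 1) L + (NR \<sigma> f L + 1)"
  have "(f + NR \<sigma> f L) + (f + 1 + NR \<sigma> (f + 1) L) \<in> span2 L"
    using A B bpoly_space.span_add by blast
  then have "?h \<in> span2 L" by (simp add: ac_simps)
  moreover have "Supp ?h \<inter> LT \<sigma> ` L = {}"
    using A B zero_notin_LT[OF \<open>1 \<notin> L\<close>]
    by (intro Supp_add_disjoint linear_bpolys_add linear_bpolys_1) auto
  ultimately have "?h = 0"
    using reduced_in_span2_eq_0[OF term_ordering_linear[OF ord] L_linear distinct] by blast
  then show ?thesis by (simp add: bpoly_add_eq_0_iff)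
qed

definition E_red :: "('v bpoly \<times> 'v bpoly) set" where
  "E_red = {(NR \<sigma> f L, NR \<sigma> g L) | f g. (f, g) \<in> E}"

definition "L' = L \<union> {b. b \<noteq> 0 \<and> (0, b) \<in> E_red} \<union> {a + 1 | a. a \<noteq> 1 \<and> (a, 1) \<in> E_red}"

definition "V' = \<Union> {{a, b} | a b. (a, b) \<in> E_red \<and> a \<notin> {0, 1} \<and> b \<notin> {0, 1} \<and> a \<noteq> b}"

definition "E' = {(a, b). (a, b) \<in> E_red \<and> a \<notin> {0, 1} \<and> b \<notin> {0, 1} \<and> a \<noteq> b}"

lemma round_eq: "round_igs \<sigma> L E = (L', V', E')"
  by (simp add: round_igs_def L'_def V'_def E'_def E_red_def Let_def)

lemma E_redE:
  assumes "(a, b) \<in> E_red"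
  obtains f g where "(f, g) \<in> E" "a = NR \<sigma> f L" "b = NR \<sigma> g L" "f \<in> linear_bpolys" "g \<in> linear_bpolys"
    "f \<in> V" "g \<in> V"
  using assms EV V_linear by (auto simp: E_red_def)

lemma E_red_linear: "(a, b) \<in> E_red \<Longrightarrow> a \<in> linear_bpolys \<and> b \<in> linear_bpolys"
  using NR_reduced(1) by (auto elim!: E_redE)

lemma L'_linear: "L' \<subseteq> linear_bpolys"
  using L_linear E_red_linear linear_bpolys_1 by (auto simp: L'_def intro: linear_bpolys_add)

lemma V'_NR: "V' \<subseteq> (\<lambda>f. NR \<sigma> f L) ` V"
  by (auto simp: V'_def elim!: E_redE)

lemma V'_linear: "V' \<subseteq> linear_bpolys"
  using V'_NR V_linear NR_reduced(1) by blast

text \<open>Lift the pair to an edge of \<open>E\<close>, use skew symmetry there and reduce again;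
  \<open>NR_add_1\<close> identifies the remainders.\<close>

lemma E'_skew:
  assumes "(f + 1, g) \<in> E'"
  shows "(g + 1, f) \<in> E'"
proof -
  from assms have "(f + 1, g) \<in> E_red" and ne: "f + 1 \<notin> {0, 1}" "g \<notin> {0, 1}" "f + 1 \<noteq> g"
    unfolding E'_def by blast+
  from this(1) obtain u v where uv: "(u, v) \<in> E" "f + 1 = NR \<sigma> u L" "g = NR \<sigma> v L"
    "u \<in> linear_bpolys" "v \<in> linear_bpolys" by (rule E_redE)
  \<comment> \<open>Otherwise all remainders would be 0, which \<open>E'\<close> excludes.\<close>
  have "1 \<notin> L" using uv ne NR_eq_0 by fastforce
  have f: "f = NR \<sigma> (u + 1) L" and g: "g + 1 = NR \<sigma> (v + 1) L"
    using NR_add_1[OF _ \<open>1 \<notin> L\<close>] uv by (simp_all flip: uv(2))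
  have "(u + 1 + 1, v) \<in> E" using uv(1) by simp
  then have "(v + 1, u + 1) \<in> E" by (rule skew)
  then have "(g + 1, f) \<in> E_red" unfolding f g E_red_def by blast
  moreover have "g + 1 \<noteq> 0" "g + 1 \<noteq> 1" "f \<noteq> 0" "f \<noteq> 1" "g + 1 \<noteq> f"
    using ne by (auto simp: bpoly_add_eq_0_iff)
  ultimately show ?thesis by (simp add: E'_def)
qed

lemma ideal_eq:
  "ideal_gen (L' \<union> {(a + 1) * b | a b. (a, b) \<in> E'}) = ideal_gen (L \<union> {(a + 1) * b | a b. (a, b) \<in> E})"
  (is "ideal_gen ?A' = ideal_gen ?A")
proof -
  have L: "ideal_gen L \<subseteq> ideal_gen ?A" by (rule ring_module.span_mono) simp
  have "ideal_gen L \<subseteq> ideal_gen L'" by (rule ring_module.span_mono) (auto simp: L'_def)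
  also have "\<dots> \<subseteq> ideal_gen ?A'" by (rule ring_module.span_mono) simp
  finally have L': "ideal_gen L \<subseteq> ideal_gen ?A'" .
  have cong: "(f + 1) * g + (NR \<sigma> f L + 1) * NR \<sigma> g L \<in> ideal_gen L"
    if "f \<in> linear_bpolys" "g \<in> linear_bpolys" for f g
  proof -
    \<comment> \<open>Replace \<open>f\<close>, then \<open>g\<close>, by its remainder; the mixed
      term arises twice and cancels.\<close>
    have "g * (f + NR \<sigma> f L) + (NR \<sigma> f L + 1) * (g + NR \<sigma> g L) \<in> ideal_gen L"
      by (intro ring_module.span_add ring_module.span_scale NR_congruent that)
    also have "g * (f + NR \<sigma> f L) + (NR \<sigma> f L + 1) * (g + NR \<sigma> g L) =
        (f + 1) * g + (NR \<sigma> f L + 1) * NR \<sigma> g L + (NR \<sigma> f L * g + NR \<sigma> f L * g)"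
      by (simp only: algebra_simps)
    finally show ?thesis by simp
  qed
  have prod': "(a + 1) * b \<in> ideal_gen ?A" if "(a, b) \<in> E_red" for a b
  proof -
    from that obtain f g where fg: "(f, g) \<in> E" "a = NR \<sigma> f L" "b = NR \<sigma> g L"
      "f \<in> linear_bpolys" "g \<in> linear_bpolys" by (rule E_redE)
    have "(f + 1) * g \<in> ideal_gen ?A"
      using fg(1) by (intro ring_module.span_base) blast
    moreover have "(f + 1) * g + (a + 1) * b \<in> ideal_gen ?A"
      using cong[OF fg(4,5)] L unfolding fg(2,3) by (rule subsetD[rotated])
    ultimately have "(f + 1) * g + ((f + 1) * g + (a + 1) * b) \<in> ideal_gen ?A"
      by (rule ring_module.span_add)
    then show ?thesis by simp
  qed
  have prod: "(f + 1) * g \<in> ideal_gen ?A'" if "(f, g) \<in> E" for f g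
  proof -
    have lin: "f \<in> linear_bpolys" "g \<in> linear_bpolys" using that EV V_linear by auto
    define a b where "a = NR \<sigma> f L" and "b = NR \<sigma> g L"
    have ab: "(a, b) \<in> E_red" using that by (auto simp: E_red_def a_def b_def)
    \<comment> \<open>For a pair dropped from \<open>E'\<close> the product is 0, or it is the
      linear polynomial appended to \<open>L'\<close>.\<close>
    have "(a + 1) * b \<in> insert 0 ?A'"
    proof (cases "(a, b) \<in> E'")
      case False
      then consider "a = 1" | "b = 0" | "a = b" | "a = 0" "b \<noteq> 0" | "a \<noteq> 1" "b = 1"
        using ab by (auto simp: E'_def)
      then show ?thesis
      proof cases
        case 3
        then have "(a + 1) * b = a * a + a" by (simp add: algebra_simps)
        also have "\<dots> = 0" using linear_bpoly_idem[of a] E_red_linear[OF ab] by simp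
        finally show ?thesis by simp
      qed (use ab in \<open>auto simp: L'_def\<close>)
    qed blast
    then have "(a + 1) * b \<in> ideal_gen ?A'"
      by (elim insertE) (simp_all only: ring_module.span_zero ring_module.span_base)
    moreover have "(f + 1) * g + (a + 1) * b \<in> ideal_gen ?A'"
      using cong[OF lin] L' unfolding a_def b_def by (rule subsetD[rotated])
    ultimately have "(f + 1) * g + (a + 1) * b + (a + 1) * b \<in> ideal_gen ?A'"
      by (rule ring_module.span_add[rotated])
    then show ?thesis by simp
  qed
  show ?thesis
  proof (rule equalityI; rule ring_module.span_minimal[OF subsetI ring_module.subspace_span])
    fix x assume "x \<in> ?A'"
    \<comment> \<open>Elements appended to \<open>L'\<close> are themselves products:
      \<open>(0 + 1) * x\<close> and \<open>(a + 1) * 1\<close>.\<close>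
    then consider "x \<in> L" | "(0, x) \<in> E_red" | a where "(a, 1) \<in> E_red" "x = a + 1"
      | a b where "(a, b) \<in> E_red" "x = (a + 1) * b"
      by (auto simp: L'_def E'_def)
    then show "x \<in> ideal_gen ?A"
    proof cases
      case 1
      then show ?thesis by (auto intro: ring_module.span_base)
    qed (use prod' in force)+
  next
    fix x assume "x \<in> ?A"
    then show "x \<in> ideal_gen ?A'"
      using prod by (auto simp: L'_def intro: ring_module.span_base)
  qed
qed

lemma round_is_igs: "is_igs F (L', V', E')"
proof -
  have "E' \<subseteq> V' \<times> V'" by (auto simp: E'_def V'_def)
  moreover have "\<forall>f\<in>V'. (f, f) \<notin> E'" by (simp add: E'_def)
  ultimately show ?thesis
    using L'_linear V'_linear E'_skew
    by (simp add: edge_products ideal_sum_eq_Un ideal_eq ideal)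
qed

text \<open>The new vertices are remainders of old ones, and \<open>L\<close> is contained in
  \<open>L'\<close>.\<close>

lemma round_preceq: "(L', V', E') \<preceq> (L, V, E)"
proof -
  have "finite V" using V_linear finite_linear_bpolys by (rule finite_subset)
  then have "card V' \<le> card V" using V'_NR by (rule surj_card_le)
  moreover have "span2 L \<subseteq> span2 L'" by (rule bpoly_space.span_mono) (auto simp: L'_def)
  ultimately show ?thesis by simp
qed

text \<open>Stated for \<open>L\<close> because remainders are reduced only with respect to it and
  \<open>L'\<close> may repeat leading terms. On returning, the two agree.\<close>

lemma round_sigma_reduced: "sigma_reduced \<sigma> (L, V', E')"
  using distinct V'_NR V_linear NR_reduced(2) by auto blast

lemma round_span_strict:
  assumes "L' \<noteq> L"
  shows "span2 L \<subset> span2 L'"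
proof -
  obtain x where x: "x \<in> L'" "x \<notin> L" using assms by (auto simp: L'_def)
  have "x \<noteq> 0 \<and> Supp x \<inter> LT \<sigma> ` L = {}"
  proof -
    from x consider "x \<noteq> 0" "(0, x) \<in> E_red" | a where "x = a + 1" "a \<noteq> 1" "(a, 1) \<in> E_red"
      by (auto simp: L'_def)
    then show ?thesis
    proof cases
      case 1
      then show ?thesis using NR_reduced(2) by (auto elim!: E_redE)
    next
      case 2
      from 2(3) obtain f g where fg: "a = NR \<sigma> f L" "1 = NR \<sigma> g L" "f \<in> linear_bpolys" "g \<in> linear_bpolys"
        by (rule E_redE)
      \<comment> \<open>A remainder equal to 1 cannot occur when \<open>1 \<in> L\<close>.\<close>
      have "1 \<notin> L" using NR_eq_0[OF _ fg(4)] fg(2) by fastforce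
      then have "Supp (a + 1) \<inter> LT \<sigma> ` L = {}"
        using zero_notin_LT NR_reduced[OF fg(3)] fg(1)
        by (intro Supp_add_disjoint linear_bpolys_1) auto
      with 2 show ?thesis by (simp add: bpoly_add_eq_0_iff)
    qed
  qed
  then have "x \<notin> span2 L"
    using reduced_in_span2_eq_0[OF term_ordering_linear[OF ord] L_linear distinct] by blast
  moreover have "x \<in> span2 L'" using x(1) by (rule bpoly_space.span_base)
  moreover have "span2 L \<subseteq> span2 L'" by (rule bpoly_space.span_mono) (auto simp: L'_def)
  ultimately show ?thesis by blast
qed

end

lemma igs_preceq_trans: "G'' \<preceq> G' \<Longrightarrow> G' \<preceq> G \<Longrightarrow> G'' \<preceq> G"
  by (cases G; cases G'; cases G'') auto

text \<open>A span lies in the ideal of its generators, so equal spans generate equal ideals and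
  interreduction is harmless.\<close>

lemma igs_change_generators:
  assumes "is_igs F (L, V, E)" "span2 M = span2 L"
  shows "is_igs F (M, V, E)"
proof -
  have sub: "ideal_gen A \<subseteq> ideal_gen B" if "span2 A = span2 B" for A B :: "'a bpoly set"
  proof (rule ring_module.span_minimal)
    have "A \<subseteq> span2 B" using that bpoly_space.span_superset by blast
    also have "span2 B \<subseteq> ideal_gen B" by (rule span2_subset_ideal_gen)
    finally show "A \<subseteq> ideal_gen B" .
  qed simp
  have "ideal_gen M = ideal_gen L" using sub assms(2) by (metis subset_antisym)
  moreover have "M \<subseteq> linear_bpolys"
    using assms span2_linear[of L] bpoly_space.span_superset[of M] by auto
  ultimately show ?thesis using assms(1) by simp
qed

section \<open>Executions\<close>

text \<open>\<open>G0\<close> is the input. The edges already processed are those outside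
  \<open>R\<close>; distinct leading terms are not demanded before interreduction, since appending
  may destroy them.\<close>

fun invariant :: "'v trm rel \<Rightarrow> 'v xnf \<Rightarrow> 'v igs \<Rightarrow> 'v state \<Rightarrow> bool" where
  "invariant \<sigma> F G0 (Interreduce G) \<longleftrightarrow> is_igs F G \<and> G \<preceq> G0"
| "invariant \<sigma> F G0 (Initialise G) \<longleftrightarrow> is_igs F G \<and> G \<preceq> G0 \<and> distinct_LTs \<sigma> (fst G)"
| "invariant \<sigma> F G0 (Loop G R G') \<longleftrightarrow> is_igs F G \<and> G \<preceq> G0 \<and> distinct_LTs \<sigma> (fst G) \<and>
     R \<subseteq> snd (snd G) \<and> G' = round_igs \<sigma> (fst G) (snd (snd G) - R)"
| "invariant \<sigma> F G0 (Return G) \<longleftrightarrow> is_igs F G \<and> G \<preceq> G0 \<and> sigma_reduced \<sigma> G"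

lemma invariant_step:
  fixes \<sigma> :: "('v::finite) trm rel"
  assumes ord: "term_ordering \<sigma>" and "ggcp_step \<sigma> s s'" "invariant \<sigma> F G0 s"
  shows "invariant \<sigma> F G0 s'"
  using assms(2,3)
proof cases
  case (interreduce L M V E)
  with assms(3) have "is_igs F (M, V, E)"
    using igs_change_generators by (auto simp del: is_igs.simps simp: LT_interreduction_def)
  moreover have "(M, V, E) \<preceq> (L, V, E)"
    using interreduce by (simp add: LT_interreduction_def)
  ultimately show ?thesis
    using interreduce assms(3) igs_preceq_trans[of "(M, V, E)" "(L, V, E)" G0]
    by (simp del: is_igs.simps igs_preceq.simps add: LT_interreduction_def)
next
  case (initialise L V E)
  with assms(3) show ?thesis by (simp add: round_igs_empty del: is_igs.simps igs_preceq.simps)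
next
  case (edge e R L V E G')
  with assms(3) have "E - (R - {e}) = insert e (E - R)" by auto
  with edge assms(3) show ?thesis
    by (auto simp: process_edge_round_igs simp del: is_igs.simps igs_preceq.simps)
next
  \<comment> \<open>No edge is left, so the accumulator is the complete round.\<close>
  case (repeat L L' V E V' E')
  with assms(3) interpret R: interreduced_igs \<sigma> F L V E
    by unfold_locales (simp_all add: ord del: is_igs.simps igs_preceq.simps)
  show ?thesis
    using repeat assms(3) R.round_is_igs igs_preceq_trans[OF R.round_preceq]
    by (simp add: R.round_eq del: is_igs.simps igs_preceq.simps)
next
  case (return L L' V E V' E')
  with assms(3) interpret R: interreduced_igs \<sigma> F L V E
    by unfold_locales (simp_all add: ord del: is_igs.simps igs_preceq.simps)
  \<comment> \<open>As \<open>L = L'\<close>, reducedness with respect to \<open>L\<close> passes to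
    the output.\<close>
  show ?thesis
    using return assms(3) R.round_is_igs R.round_sigma_reduced igs_preceq_trans[OF R.round_preceq] R.round_eq
    by (auto simp del: is_igs.simps igs_preceq.simps sigma_reduced.simps)
qed

text \<open>
  A new round starts only after the span of the linear part has grown; within a round, the second
  component orders the phases, and the third counts the edges left.
\<close>

fun state_measure :: "'v state \<Rightarrow> nat \<times> nat \<times> nat" where
  "state_measure (Interreduce G) = (card (linear_bpolys :: 'v bpoly set) - card (span2 (fst G)), 3, 0)"
| "state_measure (Initialise G) = (card (linear_bpolys :: 'v bpoly set) - card (span2 (fst G)), 2, 0)"
| "state_measure (Loop G R G') = (card (linear_bpolys :: 'v bpoly set) - card (span2 (fst G)), 1, card R)"
| "state_measure (Return G) = (card (linear_bpolys :: 'v bpoly set) - card (span2 (fst G)), 0, 0)"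

text \<open>Only \<open>repeat\<close> changes the span: interreduction preserves it, and returning
  requires \<open>L = L'\<close>.\<close>

lemma state_measure_step:
  fixes \<sigma> :: "('v::finite) trm rel"
  assumes ord: "term_ordering \<sigma>" and step: "ggcp_step \<sigma> s s'" and inv: "invariant \<sigma> F G0 s"
  shows "(state_measure s', state_measure s) \<in> less_than <*lex*> less_than <*lex*> less_than"
  using step
proof cases
  case (edge e R L V E G')
  with inv have "finite R"
    by (intro finite_subset[of R "linear_bpolys \<times> linear_bpolys"] finite_cartesian_product
          finite_linear_bpolys) auto
  then have "card (R - {e}) < card R" using edge(3) by (rule card_Diff1_less)
  with edge show ?thesis by simp
next
  case (repeat L L' V E V' E')
  with inv interpret R: interreduced_igs \<sigma> F L V E
    by unfold_locales (simp_all add: ord del: is_igs.simps igs_preceq.simps)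
  have L': "L' = R.L'" using repeat inv by (simp add: R.round_eq)
  have sub: "span2 R.L' \<subseteq> linear_bpolys" using R.L'_linear by (rule span2_linear)
  then have "card (span2 L) < card (span2 R.L')"
    using R.round_span_strict repeat(3) L' by (intro psubset_card_mono) (auto intro: finite_subset finite_linear_bpolys)
  \<comment> \<open>This bound keeps truncated subtraction from hiding the growth of the
    span.\<close>
  moreover have "card (span2 R.L') \<le> card (linear_bpolys :: 'v bpoly set)"
    using sub by (rule card_mono[OF finite_linear_bpolys])
  ultimately show ?thesis using repeat L' by simp
qed (simp_all add: LT_interreduction_def)

text \<open>Only interreduction needs a witness; the other phases always have an applicable
  rule.\<close>

lemma ggcp_progress:
  fixes \<sigma> :: "('v::finite) trm rel"
  assumes ord: "term_ordering \<sigma>" and "invariant \<sigma> F G0 s"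
  shows "(\<exists>G'. s = Return G') \<or> (\<exists>s'. ggcp_step \<sigma> s s')"
proof (cases s)
  case (Interreduce G)
  obtain L V E where G: "G = (L, V, E)" by (cases G)
  have "L \<subseteq> linear_bpolys" using assms(2) by (simp add: Interreduce G)
  then obtain M where "LT_interreduction \<sigma> L M"
    using LT_interreduction_exists[OF term_ordering_linear[OF ord]] by blast
  from ggcp_step.interreduce[OF this] show ?thesis
    unfolding Interreduce G by blast
next
  case (Initialise G)
  then show ?thesis
    using ggcp_step.initialise[of \<sigma> "fst G" "fst (snd G)" "snd (snd G)"] by auto
next
  case (Loop G R G')
  obtain L V E L' V' E' where G: "G = (L, V, E)" "G' = (L', V', E')" by (metis prod_cases3)
  show ?thesis
  proof (cases "R = {}")
    case True
    then show ?thesis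
      unfolding Loop G
      using ggcp_step.repeat[of L L' \<sigma> V E V' E'] ggcp_step.return[of L L' \<sigma> V E V' E'] by auto
  next
    case False
    then obtain e where "e \<in> R" by blast
    from ggcp_step.edge[OF this] show ?thesis unfolding Loop G by blast
  qed
next
  case (Return G)
  then show ?thesis by blast
qed

theorem proposition4p8:
  fixes \<sigma> :: "('v::finite) trm rel" and F :: "'v xnf" and G :: "'v igs"
  assumes "term_ordering \<sigma>"
    and "in_2XNF F"
    and "is_igs F G"
  shows "ggcp_terminates \<sigma> G \<and>
    (\<forall>G'. ggcp_returns \<sigma> G G' \<longrightarrow> is_igs F G' \<and> sigma_reduced \<sigma> G' \<and> G' \<preceq> G)"
proof -
  have init: "invariant \<sigma> F G (Interreduce G)"
    using assms(3) by (cases G) simp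
  \<comment> \<open>At a \<open>Return\<close> state the invariant is the claim about the
    output.\<close>
  have reach: "invariant \<sigma> F G s" if "(ggcp_step \<sigma>)\<^sup>*\<^sup>* (Interreduce G) s" for s
    using that init by (induction rule: rtranclp_induct) (auto intro: invariant_step[OF assms(1)])
  have "\<nexists>s. s 0 = Interreduce G \<and> (\<forall>i. ggcp_step \<sigma> (s i) (s (Suc i)))"
  proof (intro notI, elim exE conjE)
    fix s assume 0: "s 0 = Interreduce G" and step: "\<forall>i. ggcp_step \<sigma> (s i) (s (Suc i))"
    have "(ggcp_step \<sigma>)\<^sup>*\<^sup>* (Interreduce G) (s i)" for i
      by (induction i) (use 0 step in \<open>auto intro: rtranclp.rtrancl_into_rtrancl\<close>)
    then have "(state_measure (s (Suc i)), state_measure (s i)) \<in> less_than <*lex*> less_than <*lex*> less_than" for i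
      using state_measure_step[OF assms(1)] step reach by blast
    \<comment> \<open>An infinite execution would yield an infinite descending chain of
      measures.\<close>
    moreover have "wf (less_than <*lex*> less_than <*lex*> less_than)" by blast
    ultimately show False
      unfolding wf_iff_no_infinite_down_chain by (auto dest: spec[of _ "\<lambda>i. state_measure (s i)"])
  qed
  then have "ggcp_terminates \<sigma> G"
    unfolding ggcp_terminates_def using ggcp_progress[OF assms(1) reach] by blast
  moreover have "is_igs F G' \<and> sigma_reduced \<sigma> G' \<and> G' \<preceq> G" if "ggcp_returns \<sigma> G G'" for G'
    using reach[of "Return G'"] that unfolding ggcp_returns_def by simp
  ultimately show ?thesis by blast
qed

end
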